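(* Let $\mathrm{char}(\mathbb F)=p>0$ and $0\ne h\in R=\mathbb F[x]$. For $g\in R$, write $[D_g,\breve E_x]=D_e+\mathrm{ad}_b$, where $$b=\frac{gh^{p-1}}{\varrho_h}y^{p-1}+\sum_{k=2}^{p-1}(-1)^k\frac{(gh^{-1})^{(k-1)}h^p}{\varrho_h}\frac{y^{p-k}}{p-k}\in\mathsf N_{A_1}(A_h)$$ and $e=\big([D_g,\breve E_x]-\mathrm{ad}_b\big)(\hat y)\in\mathsf C_{A_h}(x)$. Then $$e=\frac1{\varrho_h}\left(\sum_{k=1}^{p-1}\frac{(-1)^{k-1}}{k}(gh^{p-1})^{(k)}h^{(p-k)}\right)+\frac{h^{p-1}}{\varrho_h}\Big(h\,\partial_p(g)-g\,\partial_p(h)\Big)\in R.$$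
   Context: $\mathbb F$ is a field of characteristic $p>0$, $R=\mathbb F[x]$, $0\ne h\in R$. The Weyl algebra $A_1$ is the unital associative $\mathbb F$-algebra with generators $x,y$ and relation $yx-xy=1$. $A_h$ is the unital associative $\mathbb F$-algebra with generators $x,\hat y$ and relation $\hat yx-x\hat y=h$; it is identified with the subalgebra of $A_1$ generated by $x$ and $\hat y=yh$. $\mathsf C_{A_h}(x)=\{a\in A_h\mid ax=xa\}$; for $e\in\mathsf C_{A_h}(x)$ (in particular for $e\in R$), $D_e$ is the unique derivation of $A_h$ with $D_e(x)=0$, $D_e(\hat y)=e$. With $\mathrm{ad}_u(v)=[u,v]=uv-vu$, $\mathsf N_{A_1}(A_h)=\{u\in A_1\mid[u,A_h]\subseteq A_h\}$; for $u$ in it, $\mathrm{ad}_u$ is regarded as a derivation of $A_h$. $\varrho_h$ is the unique monic polynomial of maximal degree in $\mathbb F[x^p]$ dividing $h$. $E_x\in\mathrm{Der}_{\mathbb F}(A_1)$ is given by $E_x(x)=y^{p-1}$, $E_x(y)=0$, and $\breve E_x=\frac{h^p}{\varrho_h}E_x$, which restricts to a derivation of $A_h$. Superscripts $(k)$ denote the $k$-th iterate of $\frac{d}{dx}$, on $R$ and on $R[h^{-1}]$. $\partial_p:R\to R$ is the $\mathbb F$-linear map $\partial_p\big(\sum_{i=0}^{p-1}r_ix^i\big)=\sum_{i=0}^{p-1}\frac{d}{d(x^p)}(r_i)\,x^i$ for $r_i\in\mathbb F[x^p]$. *)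

theory Defs
  imports
    "HOL-Library.Poly_Mapping"
    "HOL-Library.FuncSet"
    "HOL-Computational_Algebra.Computational_Algebra"
begin

section \<open>The Weyl algebra by generators and relations\<close>

datatype gen = GX | GY

text \<open>
  Words form the free monoid on the two generators, so that \<open>word \<Rightarrow>\<^sub>0 'a\<close>, with the convolution
  product of the library, is the free unital associative algebra.  Lists are wrapped in a datatype
  because the additive structure on them has to be concatenation.
\<close>

datatype word = Word (letters: "gen list")

instantiation word :: monoid_add
begin

definition zero_word :: word where
  "0 = Word []"

definition plus_word :: "word \<Rightarrow> word \<Rightarrow> word" where
  "u + v = Word (letters u @ letters v)"

instance
  by standard (simp_all add: zero_word_def plus_word_def)

end

type_synonym 'a free_alg = "word \<Rightarrow>\<^sub>0 'a"

definition free_gen :: "gen \<Rightarrow> 'a::field free_alg" where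
  "free_gen s = Poly_Mapping.single (Word [s]) 1"

definition weyl_relator :: "'a::field free_alg" where
  "weyl_relator = free_gen GY * free_gen GX - free_gen GX * free_gen GY - 1"

inductive_set weyl_ideal :: "'a::field free_alg set" where
  zero: "0 \<in> weyl_ideal"
| add: "a \<in> weyl_ideal \<Longrightarrow> b \<in> weyl_ideal \<Longrightarrow> a + b \<in> weyl_ideal"
| relator: "a * weyl_relator * b \<in> weyl_ideal"

lemma weyl_ideal_uminus: "a \<in> weyl_ideal \<Longrightarrow> - a \<in> weyl_ideal"
proof (induction rule: weyl_ideal.induct)
  case (relator a b)
  then show ?case using weyl_ideal.relator[of "- a" b] by simp
next
  case (add a b)
  then show ?case using weyl_ideal.add[of "- a" "- b"] by simp
qed (simp add: weyl_ideal.zero)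

lemma weyl_ideal_diff: "a \<in> weyl_ideal \<Longrightarrow> b \<in> weyl_ideal \<Longrightarrow> a - b \<in> weyl_ideal"
  using weyl_ideal.add[OF _ weyl_ideal_uminus, of a b] by simp

lemma weyl_ideal_mult_left: "a \<in> weyl_ideal \<Longrightarrow> c * a \<in> weyl_ideal"
proof (induction rule: weyl_ideal.induct)
  case (relator a b)
  then show ?case using weyl_ideal.relator[of "c * a" b] by (simp add: mult.assoc)
qed (simp_all add: weyl_ideal.zero weyl_ideal.add distrib_left)

lemma weyl_ideal_mult_right: "a \<in> weyl_ideal \<Longrightarrow> a * c \<in> weyl_ideal"
proof (induction rule: weyl_ideal.induct)
  case (relator a b)
  then show ?case using weyl_ideal.relator[of a "b * c"] by (simp add: mult.assoc)
qed (simp_all add: weyl_ideal.zero weyl_ideal.add distrib_right)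

text \<open>
  The type class of unital rings requires \<open>0 \<noteq> 1\<close>, that is, \<open>1\<close> must not lie in the ideal.  This
  is seen from the action on polynomials in which \<open>x\<close> multiplies and \<open>y\<close> differentiates.
\<close>

fun gen_act :: "gen \<Rightarrow> 'a::field poly \<Rightarrow> 'a poly" where
  "gen_act GX q = [:0, 1:] * q"
| "gen_act GY q = pderiv q"

definition word_act :: "word \<Rightarrow> 'a::field poly \<Rightarrow> 'a poly" where
  "word_act w q = foldr gen_act (letters w) q"

definition free_act :: "'a::field free_alg \<Rightarrow> 'a poly \<Rightarrow> 'a poly" where
  "free_act a q = (\<Sum>w\<in>Poly_Mapping.keys a. smult (Poly_Mapping.lookup a w) (word_act w q))"

lemma gen_act_add: "gen_act s (q + r) = gen_act s q + gen_act s r"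
  by (cases s) (simp_all add: distrib_left pderiv_add)

lemma gen_act_smult: "gen_act s (smult c q) = smult c (gen_act s q)"
  by (cases s) (simp_all add: pderiv_smult)

lemma word_act_add: "word_act w (q + r) = word_act w q + word_act w r"
proof -
  have "foldr gen_act l (q + r) = foldr gen_act l q + foldr gen_act l r" for l
    by (induction l) (simp_all add: gen_act_add)
  then show ?thesis by (simp add: word_act_def)
qed

lemma word_act_smult: "word_act w (smult c q) = smult c (word_act w q)"
proof -
  have "foldr gen_act l (smult c q) = smult c (foldr gen_act l q)" for l
    by (induction l) (simp_all add: gen_act_smult)
  then show ?thesis by (simp add: word_act_def)
qed

lemma word_act_zero: "word_act w (0 :: 'a::field poly) = 0"
  using word_act_smult[of w 0 "0 :: 'a poly"] by simp

lemma word_act_plus: "word_act (u + v) q = word_act u (word_act v q)"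
  by (simp add: word_act_def plus_word_def)

lemma free_act_superset:
  assumes "finite S" "Poly_Mapping.keys a \<subseteq> S"
  shows "free_act a q = (\<Sum>w\<in>S. smult (Poly_Mapping.lookup a w) (word_act w q))"
  unfolding free_act_def
  by (rule sum.mono_neutral_left) (use assms in \<open>auto simp: in_keys_iff\<close>)

lemma free_act_add: "free_act (a + b) q = free_act a q + free_act b q"
proof -
  let ?S = "Poly_Mapping.keys a \<union> Poly_Mapping.keys b"
  have "Poly_Mapping.keys (a + b) \<subseteq> ?S" by (rule keys_add)
  then show ?thesis
    by (simp add: free_act_superset[of ?S] lookup_add smult_add_left sum.distrib)
qed

lemma free_act_single: "free_act (Poly_Mapping.single w c) q = smult c (word_act w q)"
  by (subst free_act_superset[of "{w}"]) auto

lemma free_act_zero: "free_act 0 q = 0"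
  by (simp add: free_act_def)

lemma free_act_add_right: "free_act a (q + r) = free_act a q + free_act a r"
  by (simp add: free_act_def word_act_add smult_add_right sum.distrib)

lemma free_act_zero_right: "free_act a 0 = 0"
  by (simp add: free_act_def word_act_zero)

lemma free_alg_induct [case_names zero single add]:
  fixes a :: "'a::field free_alg"
  assumes "P 0" "\<And>w c. P (Poly_Mapping.single w c)" "\<And>a b. P a \<Longrightarrow> P b \<Longrightarrow> P (a + b)"
  shows "P a"
proof (induction a rule: update_induct)
  case const
  show ?case by (rule assms(1))
next
  case (update f w c)
  have "Poly_Mapping.update w c f = f + Poly_Mapping.single w c"
    using update.hyps
    by (intro poly_mapping_eqI) (auto simp: lookup_update lookup_add lookup_single in_keys_iff)
  then show ?case using assms(3)[OF update.IH assms(2)] by simp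
qed

lemma free_act_mult: "free_act (a * b) q = free_act a (free_act b q)"
proof (induction a rule: free_alg_induct)
  case zero
  then show ?case by (simp add: free_act_zero)
next
  case (add a a')
  then show ?case by (simp add: distrib_right free_act_add)
next
  case (single w c)
  show ?case
  proof (induction b rule: free_alg_induct)
    case zero
    then show ?case by (simp add: free_act_zero free_act_zero_right)
  next
    case (single v d)
    then show ?case
      by (simp add: mult_single free_act_single word_act_plus word_act_smult)
  next
    case (add b b')
    then show ?case by (simp add: distrib_left free_act_add free_act_add_right)
  qed
qed

lemma free_act_uminus: "free_act (- a) q = - free_act a q"
  using free_act_add[of a "- a" q] by (simp add: free_act_zero eq_neg_iff_add_eq_0 add.commute)

lemma free_act_one: "free_act 1 q = q"
proof -
  have "free_act (Poly_Mapping.single 0 1) q = q"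
    unfolding free_act_single by (simp add: word_act_def zero_word_def)
  then show ?thesis by simp
qed

lemma free_act_relator: "free_act weyl_relator q = 0"
  by (simp add: weyl_relator_def diff_conv_add_uminus free_act_add free_act_uminus free_act_mult
      free_act_one free_gen_def free_act_single word_act_def pderiv_pCons del: add_uminus_conv_diff)

lemma free_act_ideal: "a \<in> weyl_ideal \<Longrightarrow> free_act a q = 0"
proof (induction arbitrary: q rule: weyl_ideal.induct)
  case (relator a b)
  then show ?case by (simp add: free_act_mult free_act_relator free_act_zero_right)
qed (simp_all add: free_act_zero free_act_add)

lemma one_notin_weyl_ideal: "1 \<notin> weyl_ideal"
  using free_act_ideal[of 1 1] by (auto simp: free_act_one)

quotient_type (overloaded) 'a weyl = "'a::field free_alg" / "\<lambda>a b. a - b \<in> weyl_ideal"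
proof (rule equivpI)
  show "reflp (\<lambda>a b :: 'a free_alg. a - b \<in> weyl_ideal)"
    by (simp add: reflp_def weyl_ideal.zero)
  show "symp (\<lambda>a b :: 'a free_alg. a - b \<in> weyl_ideal)"
    using weyl_ideal_uminus by (fastforce simp: symp_def)
  show "transp (\<lambda>a b :: 'a free_alg. a - b \<in> weyl_ideal)"
    using weyl_ideal.add by (fastforce simp: transp_def)
qed

instantiation weyl :: (field) ring_1
begin

lift_definition zero_weyl :: "'a weyl" is 0 .

lift_definition one_weyl :: "'a weyl" is 1 .

lift_definition plus_weyl :: "'a weyl \<Rightarrow> 'a weyl \<Rightarrow> 'a weyl" is "(+)"
  by (simp only: add_diff_add weyl_ideal.add)

lift_definition minus_weyl :: "'a weyl \<Rightarrow> 'a weyl \<Rightarrow> 'a weyl" is "(-)"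
proof -
  fix a a' b b' :: "'a free_alg"
  assume "a - a' \<in> weyl_ideal" "b - b' \<in> weyl_ideal"
  then have "(a - a') - (b - b') \<in> weyl_ideal" by (rule weyl_ideal_diff)
  then show "a - b - (a' - b') \<in> weyl_ideal" by (simp add: algebra_simps)
qed

lift_definition uminus_weyl :: "'a weyl \<Rightarrow> 'a weyl" is uminus
  by (simp only: minus_diff_minus weyl_ideal_uminus)

lift_definition times_weyl :: "'a weyl \<Rightarrow> 'a weyl \<Rightarrow> 'a weyl" is "(*)"
proof -
  fix a a' b b' :: "'a free_alg"
  assume "a - a' \<in> weyl_ideal" "b - b' \<in> weyl_ideal"
  then have "(a - a') * b + a' * (b - b') \<in> weyl_ideal"
    by (intro weyl_ideal.add weyl_ideal_mult_left weyl_ideal_mult_right)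
  then show "a * b - a' * b' \<in> weyl_ideal" by (simp add: algebra_simps)
qed

instance
proof
  show "(0 :: 'a weyl) \<noteq> 1"
    by transfer (use weyl_ideal_uminus[of "- 1"] one_notin_weyl_ideal in auto)
qed (transfer; simp add: algebra_simps weyl_ideal.zero)+

end

lift_definition weyl_X :: "'a::field weyl" is "free_gen GX" .

lift_definition weyl_Y :: "'a::field weyl" is "free_gen GY" .

lift_definition weyl_const :: "'a::field \<Rightarrow> 'a weyl" is "Poly_Mapping.single 0" .

lemma weyl_relation: "weyl_Y * weyl_X - weyl_X * weyl_Y = (1 :: 'a::field weyl)"
  by transfer (use weyl_ideal.relator[of 1 1] in \<open>simp add: weyl_relator_def\<close>)

definition weyl_poly :: "'a::field poly \<Rightarrow> 'a weyl" where
  "weyl_poly f = (\<Sum>i\<le>degree f. weyl_const (coeff f i) * weyl_X ^ i)"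


section \<open>Rational functions\<close>

abbreviation poly_fract :: "'a::field poly \<Rightarrow> 'a poly fract" where
  "poly_fract f \<equiv> Fraction_Field.Fract f 1"

text \<open>
  The extension of \<open>d/dx\<close> to the field of rational functions; on \<open>R[1/h]\<close> it restricts to the
  derivation meant by the superscripts \<open>(k)\<close>.
\<close>

definition fract_pderiv :: "'a::field poly fract \<Rightarrow> 'a poly fract" where
  "fract_pderiv q = (THE d. \<forall>a b. b \<noteq> 0 \<and> q = Fraction_Field.Fract a b \<longrightarrow>
     d = Fraction_Field.Fract (pderiv a * b - a * pderiv b) (b * b))"

lemma fract_pderiv_Fract:
  fixes a b :: "'a::field poly"
  assumes b: "b \<noteq> 0"
  shows "fract_pderiv (Fraction_Field.Fract a b) =
    Fraction_Field.Fract (pderiv a * b - a * pderiv b) (b * b)"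
proof -
  have wd: "Fraction_Field.Fract (pderiv a * b - a * pderiv b) (b * b) =
      Fraction_Field.Fract (pderiv c * d - c * pderiv d) (d * d)"
    if d: "d \<noteq> 0" and eq': "Fraction_Field.Fract a b = Fraction_Field.Fract c d" for c d
  proof -
    have eq: "a * d = c * b" using eq' b d by (simp add: eq_fract)
    have deq: "pderiv a * d + a * pderiv d = pderiv c * b + c * pderiv b"
      using arg_cong[OF eq, of pderiv] by (simp add: pderiv_mult algebra_simps)
    have "(pderiv a * b - a * pderiv b) * (d * d) - (pderiv c * d - c * pderiv d) * (b * b) =
        b * d * ((pderiv a * d + a * pderiv d) - (pderiv c * b + c * pderiv b)) -
        (a * d - c * b) * (b * pderiv d + d * pderiv b)"
      by (simp add: algebra_simps)
    also have "\<dots> = 0" using eq deq by simp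
    finally show ?thesis using b d by (simp add: eq_fract)
  qed
  show ?thesis
    unfolding fract_pderiv_def by (rule the_equality) (use b wd in blast)+
qed

lemma fract_pderiv_poly: "fract_pderiv (poly_fract f) = poly_fract (pderiv f)"
  by (simp add: fract_pderiv_Fract)

text \<open>
  Only meaningful for rational functions that are polynomials.  It allows coefficients such as
  \<open>(g/h)\<^bsup>(k-1)\<^esup> h\<^sup>p / \<rho>\<^sub>h\<close>, which are polynomials although their factors are not, to be used in the
  Weyl algebra.
\<close>

definition weyl_fract :: "'a::field poly fract \<Rightarrow> 'a weyl" where
  "weyl_fract q = weyl_poly (THE f. poly_fract f = q)"


section \<open>Derivations and the subalgebra \<open>A\<^sub>h\<close>\<close>

definition commutator :: "'b::ring \<Rightarrow> 'b \<Rightarrow> 'b" where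
  "commutator u v = u * v - v * u"

definition map_commutator :: "('b::ab_group_add \<Rightarrow> 'b) \<Rightarrow> ('b \<Rightarrow> 'b) \<Rightarrow> 'b \<Rightarrow> 'b" where
  "map_commutator D E = (\<lambda>a. D (E a) - E (D a))"

inductive_set subalgebra_gen :: "'a::field weyl set \<Rightarrow> 'a weyl set" for S where
  const: "weyl_const c \<in> subalgebra_gen S"
| base: "a \<in> S \<Longrightarrow> a \<in> subalgebra_gen S"
| add: "a \<in> subalgebra_gen S \<Longrightarrow> b \<in> subalgebra_gen S \<Longrightarrow> a + b \<in> subalgebra_gen S"
| mult: "a \<in> subalgebra_gen S \<Longrightarrow> b \<in> subalgebra_gen S \<Longrightarrow> a * b \<in> subalgebra_gen S"

definition y_hat :: "'a::field poly \<Rightarrow> 'a weyl" where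
  "y_hat h = weyl_Y * weyl_poly h"

definition A_sub :: "'a::field poly \<Rightarrow> 'a weyl set" where
  "A_sub h = subalgebra_gen {weyl_X, y_hat h}"

definition derivation_on :: "'a::field weyl set \<Rightarrow> ('a weyl \<Rightarrow> 'a weyl) \<Rightarrow> bool" where
  "derivation_on A D \<longleftrightarrow>
     D \<in> A \<rightarrow> A \<and>
     (\<forall>a\<in>A. \<forall>b\<in>A. D (a + b) = D a + D b) \<and>
     (\<forall>c. \<forall>a\<in>A. D (weyl_const c * a) = weyl_const c * D a) \<and>
     (\<forall>a\<in>A. \<forall>b\<in>A. D (a * b) = D a * b + a * D b)"

definition centralizer_X :: "'a::field poly \<Rightarrow> 'a weyl set" where
  "centralizer_X h = {a \<in> A_sub h. a * weyl_X = weyl_X * a}"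

definition normalizer :: "'a::field poly \<Rightarrow> 'a weyl set" where
  "normalizer h = {u. \<forall>a\<in>A_sub h. commutator u a \<in> A_sub h}"

text \<open>
  A derivation of \<open>A\<^sub>h\<close> is a map on all of \<open>A\<^sub>1\<close> here; extensionality fixes its values outside
  \<open>A\<^sub>h\<close> and thereby makes it unique.
\<close>

definition D_der :: "'a::field poly \<Rightarrow> 'a weyl \<Rightarrow> 'a weyl \<Rightarrow> 'a weyl" where
  "D_der h e = (THE D. D \<in> extensional (A_sub h) \<and> derivation_on (A_sub h) D \<and>
     D weyl_X = 0 \<and> D (y_hat h) = e)"

definition E_x :: "'a::field weyl \<Rightarrow> 'a weyl" where
  "E_x = (THE E. derivation_on UNIV E \<and> E weyl_X = weyl_Y ^ (CHAR('a) - 1) \<and> E weyl_Y = 0)"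


section \<open>The polynomial \<open>\<rho>\<^sub>h\<close> and the operator \<open>\<partial>\<^sub>p\<close>\<close>

definition polys_in_xp :: "'a::field poly set" where
  "polys_in_xp = range (\<lambda>f. pcompose f (monom 1 CHAR('a)))"

definition rho :: "'a::field poly \<Rightarrow> 'a poly" where
  "rho h = (THE r.
     (r \<in> polys_in_xp \<and> lead_coeff r = 1 \<and> r dvd h) \<and>
     (\<forall>s. s \<in> polys_in_xp \<and> lead_coeff s = 1 \<and> s dvd h \<longrightarrow> degree s \<le> degree r))"

definition E_breve :: "'a::field poly \<Rightarrow> 'a weyl \<Rightarrow> 'a weyl" where
  "E_breve h a = weyl_fract (poly_fract (h ^ CHAR('a)) / poly_fract (rho h)) * E_x a"

text \<open>
  \<open>xp_part f i\<close> is the polynomial \<open>s\<^sub>i\<close> with \<open>f = (\<Sum>i<p. s\<^sub>i(x\<^sup>p) x\<^sup>i)\<close>, so that the derivative of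
  \<open>r\<^sub>i = s\<^sub>i(x\<^sup>p)\<close> with respect to \<open>x\<^sup>p\<close> is \<open>s\<^sub>i'(x\<^sup>p)\<close>.
\<close>

definition xp_part :: "'a::field poly \<Rightarrow> nat \<Rightarrow> 'a poly" where
  "xp_part f i = (\<Sum>m\<le>degree f. monom (coeff f (CHAR('a) * m + i)) m)"

definition partial_p :: "'a::field poly \<Rightarrow> 'a poly" where
  "partial_p f = (\<Sum>i<CHAR('a).
     pcompose (pderiv (xp_part f i)) (monom 1 CHAR('a)) * monom 1 i)"

end

theory Submission
  imports Defs "HOL-Library.Product_Plus"
begin

text \<open>
  In the Weyl algebra over the integers, \<open>[y\<^sup>p, f]\<close> is divisible by \<open>p\<close>, and \<open>E\<^sub>x\<close> is the reduction
  modulo \<open>p\<close> of \<open>ad(y\<^sup>p) / p\<close>.  For a polynomial \<open>f\<close>, the terms of \<open>[y\<^sup>p, f] / p\<close> that contain \<open>y\<close> have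
  the coefficients \<open>(p choose k) / p\<close>, which are \<open>(-1)\<^bsup>k-1\<^esup> / k\<close> modulo \<open>p\<close>, and the
  last term is \<open>(p-1)!\<close>, which is \<open>-1\<close> modulo \<open>p\<close>, times the \<open>p\<close>-th Hasse derivative of \<open>f\<close>, which is \<open>\<partial>\<^sub>p f\<close>.  Hence
  \<open>E\<^sub>x(f) = T(f') - \<partial>\<^sub>p(f)\<close> with \<open>T(f) = \<Sum>\<^sub>k (-1)\<^bsup>k-1\<^esup>/k f\<^bsup>(k-1)\<^esup> y\<^bsup>p-k\<^esup>\<close> (\<open>E_x_poly\<close>, where \<open>T\<close> is
  \<open>divided_comm\<close>).  This yields the Leibniz rule of \<open>\<partial>\<^sub>p\<close>, whose error term is the sum over \<open>k\<close> in the
  formula for \<open>e\<close> (\<open>partial_p_mult\<close>).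

  Put \<open>u = g h\<^bsup>p-1\<^esup>\<close>, \<open>w = u / \<rho>\<^sub>h\<close> and \<open>z = h\<^sup>p / \<rho>\<^sub>h\<close>; these are polynomials.  As \<open>h\<^sup>p\<close> and
  \<open>\<rho>\<^sub>h\<close> have derivative 0, \<open>(g/h)\<^bsup>(j)\<^esup> h\<^sup>p / \<rho>\<^sub>h = w\<^bsup>(j)\<^esup>\<close>, so that \<open>b = T(w)\<close> (\<open>B_eq\<close>).  Since \<open>D\<^sub>g\<close> should
  map \<open>y\<close> to \<open>g/h\<close>, it does not act on \<open>A\<^sub>1\<close>, but \<open>h\<^sup>p D\<^sub>g\<close> does: it is the derivation with \<open>x \<mapsto> 0\<close> and
  \<open>y \<mapsto> u\<close>.  As \<open>h\<^sup>p\<close> is central and polynomials can be cancelled in \<open>A\<^sub>1\<close> (\<open>weyl_poly_mult_cancel\<close>), \<open>D\<^sub>g\<close>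
  is obtained from this derivation by division, and identities about \<open>D\<^sub>g\<close> can be checked after
  multiplication by \<open>h\<^sup>p\<close> (\<open>D_der_props\<close>).

  Let \<open>\<Delta> = [D\<^sub>g, z E\<^sub>x] - ad\<^sub>b\<close>, a map on \<open>A\<^sub>h\<close> that satisfies the Leibniz rule.  It kills \<open>x\<close>, because
  \<open>[T(u), x]\<close> is the image of \<open>y\<^bsup>p-1\<^esup>\<close> under \<open>h\<^sup>p D\<^sub>g\<close> (\<open>divided_comm_X\<close>).  Hence it kills all polynomials,
  and \<open>\<Delta>(y h) h\<^bsup>p-1\<^esup> = \<Delta>(h\<^sup>p y)\<close>.  The right-hand side is easy, as \<open>D\<^sub>g(h\<^sup>p y) = u\<close> is a polynomial:
  the sums \<open>T\<close> cancel and \<open>z \<partial>\<^sub>p(u) - w \<partial>\<^sub>p(h\<^sup>p)\<close> remains.  The Leibniz rule of \<open>\<partial>\<^sub>p\<close>, applied to both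
  sides of \<open>u h = g h\<^sup>p\<close>, turns \<open>h\<close> times this into \<open>h\<^sup>p\<close> times the asserted value of \<open>e\<close>
  (\<open>\<Delta>_y_hat\<close>).  So \<open>\<Delta>\<close> agrees with \<open>D\<^sub>e\<close> on both generators of \<open>A\<^sub>h\<close>, and hence on \<open>A\<^sub>h\<close>.  Finally, \<open>ad\<^sub>b\<close>
  preserves \<open>A\<^sub>h\<close> because \<open>D\<^sub>g\<close>, \<open>z E\<^sub>x\<close> and \<open>D\<^sub>e\<close> do.
\<close>

section \<open>Constants and polynomials in the Weyl algebra\<close>

lemma weyl_const_add: "weyl_const (c + d) = weyl_const c + weyl_const d"
  by transfer (simp add: single_add weyl_ideal.zero)

lemma weyl_const_mult: "weyl_const (c * d) = weyl_const c * weyl_const d"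
  by transfer (simp add: mult_single weyl_ideal.zero)

lemma weyl_const_0 [simp]: "weyl_const 0 = 0"
  by transfer (simp add: weyl_ideal.zero)

lemma weyl_const_1 [simp]: "weyl_const 1 = 1"
  by transfer (simp add: weyl_ideal.zero)

lemma weyl_const_uminus: "weyl_const (- c) = - weyl_const c"
  using weyl_const_add[of c "- c"] by (simp add: eq_neg_iff_add_eq_0 add.commute)

lemma single_0_commute:
  fixes a :: "'a::field free_alg"
  shows "Poly_Mapping.single 0 c * a = a * Poly_Mapping.single 0 c"
  by (induction a rule: free_alg_induct) (simp_all add: mult_single mult.commute distrib_left distrib_right)

lemma weyl_const_commute: "weyl_const c * a = a * weyl_const c"
  by transfer (simp add: single_0_commute weyl_ideal.zero)

lemma weyl_const_of_nat: "weyl_const (of_nat n) = of_nat n"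
  by (induction n) (simp_all add: weyl_const_add)

lemma weyl_of_word: "abs_weyl (Poly_Mapping.single (Word l) 1) =
    foldr (\<lambda>s a. (case s of GX \<Rightarrow> weyl_X | GY \<Rightarrow> weyl_Y) * a) l (1 :: 'a::field weyl)"
proof (induction l)
  case Nil
  show ?case
    by (simp add: one_weyl_def flip: zero_word_def)
next
  case (Cons s l)
  have "Poly_Mapping.single (Word (s # l)) 1 = free_gen s * (Poly_Mapping.single (Word l) 1 :: 'a free_alg)"
    by (simp add: free_gen_def mult_single plus_word_def)
  moreover have "(case s of GX \<Rightarrow> weyl_X | GY \<Rightarrow> weyl_Y) = (abs_weyl (free_gen s) :: 'a weyl)"
    by (cases s) (simp_all add: weyl_X_def weyl_Y_def)
  ultimately show ?case
    unfolding foldr.simps comp_apply Cons.IH[symmetric] by (simp only: times_weyl.abs_eq)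
qed

lemma weyl_induct [case_names const X Y add mult]:
  fixes a :: "'a::field weyl"
  assumes const: "\<And>c. P (weyl_const c)" and X: "P weyl_X" and Y: "P weyl_Y"
    and add: "\<And>a b. P a \<Longrightarrow> P b \<Longrightarrow> P (a + b)" and mult: "\<And>a b. P a \<Longrightarrow> P b \<Longrightarrow> P (a * b)"
  shows "P a"
proof -
  have word: "P (abs_weyl (Poly_Mapping.single (Word l) 1))" for l
    unfolding weyl_of_word
    by (induction l) (use const[of 1] X Y mult in \<open>auto split: gen.split\<close>)
  have "P (abs_weyl r)" for r
  proof (induction r rule: free_alg_induct)
    case zero
    then show ?case using const[of 0] by (simp flip: zero_weyl_def)
  next
    case (single w c)
    have "Poly_Mapping.single w c = Poly_Mapping.single 0 c * Poly_Mapping.single w 1"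
      by (simp add: mult_single)
    then have "abs_weyl (Poly_Mapping.single w c) = weyl_const c * abs_weyl (Poly_Mapping.single w 1)"
      by (simp add: times_weyl.abs_eq weyl_const.abs_eq)
    then show ?case using mult[OF const word] by (cases w) simp
  next
    case (add a b)
    then show ?case using assms(4) by (simp flip: plus_weyl.abs_eq)
  qed
  then show ?thesis by (induction a rule: weyl.abs_induct)
qed

lemma weyl_poly_0 [simp]: "weyl_poly 0 = 0"
  by (simp add: weyl_poly_def)

lemma weyl_poly_superset:
  "degree f \<le> n \<Longrightarrow> weyl_poly f = (\<Sum>i\<le>n. weyl_const (coeff f i) * weyl_X ^ i)"
  unfolding weyl_poly_def
  by (rule sum.mono_neutral_left) (auto simp: coeff_eq_0)

lemma weyl_poly_pCons: "weyl_poly (pCons c f) = weyl_const c + weyl_X * weyl_poly f"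
proof -
  have "weyl_poly (pCons c f) = (\<Sum>i\<le>Suc (degree f). weyl_const (coeff (pCons c f) i) * weyl_X ^ i)"
    by (rule weyl_poly_superset) (rule degree_pCons_le)
  also have "\<dots> = weyl_const c + (\<Sum>i\<le>degree f. weyl_const (coeff f i) * weyl_X ^ Suc i)"
    by (subst sum.atMost_Suc_shift) simp
  also have "(\<Sum>i\<le>degree f. weyl_const (coeff f i) * weyl_X ^ Suc i) = weyl_X * weyl_poly f"
    by (simp add: weyl_poly_def sum_distrib_left weyl_const_commute[of _ "weyl_X ^ _"]
        weyl_const_commute[of _ "weyl_X * weyl_X ^ _"] mult.assoc)
  finally show ?thesis .
qed

lemma weyl_poly_const: "weyl_poly [:c:] = weyl_const c"
  by (simp add: weyl_poly_pCons)

lemma weyl_poly_1 [simp]: "weyl_poly 1 = 1"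
  by (simp add: weyl_poly_const one_pCons)

lemma weyl_poly_X: "weyl_poly [:0, 1:] = weyl_X"
  by (simp add: weyl_poly_pCons)

lemma weyl_poly_add: "weyl_poly (f + g) = weyl_poly f + weyl_poly g"
  by (induction f g rule: poly_induct2)
     (simp_all add: weyl_poly_pCons weyl_const_add distrib_left algebra_simps)

lemma weyl_poly_smult: "weyl_poly (smult c f) = weyl_const c * weyl_poly f"
proof (induction f)
  case (pCons d f)
  have "weyl_X * (weyl_const c * weyl_poly f) = weyl_const c * (weyl_X * weyl_poly f)"
    by (metis mult.assoc weyl_const_commute)
  then show ?case using pCons.IH by (simp add: weyl_poly_pCons weyl_const_mult distrib_left)
qed simp

lemma weyl_poly_mult: "weyl_poly (f * g) = weyl_poly f * weyl_poly g"
  by (induction f)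
     (simp_all add: weyl_poly_pCons weyl_poly_add weyl_poly_smult distrib_right mult.assoc)

lemma weyl_poly_uminus: "weyl_poly (- f) = - weyl_poly f"
  using weyl_poly_add[of f "- f"] by (simp add: eq_neg_iff_add_eq_0 add.commute)

lemma weyl_poly_diff: "weyl_poly (f - g) = weyl_poly f - weyl_poly g"
  using weyl_poly_add[of f "- g"] by (simp add: weyl_poly_uminus)

lemma weyl_poly_commute: "weyl_poly f * weyl_poly g = weyl_poly g * weyl_poly f"
  by (simp add: mult.commute flip: weyl_poly_mult)

lemma weyl_Y_X: "weyl_Y * weyl_X = weyl_X * weyl_Y + (1 :: 'a::field weyl)"
  using weyl_relation by (simp add: algebra_simps)

lemma weyl_Y_poly: "weyl_Y * weyl_poly f = weyl_poly f * weyl_Y + weyl_poly (pderiv f)"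
proof (induction f)
  case (pCons c f)
  have "weyl_Y * weyl_poly (pCons c f) = weyl_const c * weyl_Y + (weyl_Y * weyl_X) * weyl_poly f"
    by (simp add: weyl_poly_pCons distrib_left weyl_const_commute[of c weyl_Y] mult.assoc)
  also have "\<dots> = weyl_const c * weyl_Y + weyl_X * (weyl_Y * weyl_poly f) + weyl_poly f"
    by (simp add: weyl_Y_X distrib_right mult.assoc add.assoc)
  also have "\<dots> = weyl_poly (pCons c f) * weyl_Y + weyl_poly (pderiv (pCons c f))"
    unfolding pCons.IH
    by (simp add: weyl_poly_pCons pderiv_pCons weyl_poly_add distrib_left distrib_right mult.assoc)
  finally show ?case .
qed simp

lemma weyl_Y_power_poly:
  "weyl_Y ^ n * weyl_poly f =
     (\<Sum>j\<le>n. of_nat (n choose j) * (weyl_poly ((pderiv ^^ j) f) * weyl_Y ^ (n - j)))"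
proof (induction n)
  case (Suc n)
  let ?t = "\<lambda>j m. weyl_poly ((pderiv ^^ j) f) * weyl_Y ^ m"
  have Y: "weyl_Y * (of_nat k * ?t j m) = of_nat k * ?t j (Suc m) + of_nat k * ?t (Suc j) m" for k j m
  proof -
    have "weyl_Y * (of_nat k * ?t j m) = (of_nat k * weyl_Y) * ?t j m"
      by (simp add: mult_of_nat_commute[of k weyl_Y] flip: mult.assoc)
    also have "\<dots> = of_nat k * ((weyl_Y * weyl_poly ((pderiv ^^ j) f)) * weyl_Y ^ m)"
      by (simp add: mult.assoc)
    finally show ?thesis
      by (simp add: weyl_Y_poly distrib_left distrib_right mult.assoc)
  qed
  have "weyl_Y ^ Suc n * weyl_poly f = (\<Sum>j\<le>n. weyl_Y * (of_nat (n choose j) * ?t j (n - j)))"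
    using Suc by (simp add: mult.assoc sum_distrib_left)
  also have "\<dots> = (\<Sum>j\<le>n. of_nat (n choose j) * ?t j (Suc n - j))
      + (\<Sum>j\<le>n. of_nat (n choose j) * ?t (Suc j) (n - j))"
    unfolding Y sum.distrib
    by (intro arg_cong2[where f = "(+)"] sum.cong) (simp_all add: Suc_diff_le)
  also have "(\<Sum>j\<le>n. of_nat (n choose j) * ?t j (Suc n - j))
      = (\<Sum>j\<le>Suc n. of_nat (n choose j) * ?t j (Suc n - j))"
    by (simp add: binomial_eq_0)
  also have "\<dots> = ?t 0 (Suc n) + (\<Sum>j\<le>n. of_nat (n choose Suc j) * ?t (Suc j) (n - j))"
    by (subst sum.atMost_Suc_shift) simp
  also have "?t 0 (Suc n) + (\<Sum>j\<le>n. of_nat (n choose Suc j) * ?t (Suc j) (n - j))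
       + (\<Sum>j\<le>n. of_nat (n choose j) * ?t (Suc j) (n - j))
     = ?t 0 (Suc n) + (\<Sum>j\<le>n. of_nat (Suc n choose Suc j) * ?t (Suc j) (n - j))"
    by (simp add: distrib_right sum.distrib add.assoc add.commute del: funpow.simps)
  also have "\<dots> = (\<Sum>j\<le>Suc n. of_nat (Suc n choose j) * ?t j (Suc n - j))"
    by (subst sum.atMost_Suc_shift) simp
  finally show ?case .
qed simp

lemma weyl_Y_power_X:
  fixes Y X :: "'a::field weyl"
  defines "Y \<equiv> weyl_Y" and "X \<equiv> weyl_X"
  shows
  "Y ^ n * X = X * Y ^ n + of_nat n * Y ^ (n - 1)"
proof (induction n)
  case (Suc n)
  have "Y ^ Suc n * X = Y * (X * Y ^ n) + (Y * of_nat n) * Y ^ (n - 1)"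
    using Suc by (simp add: mult.assoc distrib_left)
  also have "(Y * of_nat n) * Y ^ (n - 1) = of_nat n * (Y * Y ^ (n - 1))"
    by (simp add: mult.assoc flip: mult_of_nat_commute)
  also have "of_nat n * (Y * Y ^ (n - 1)) = of_nat n * Y ^ n"
    by (cases n) simp_all
  also have "Y * (X * Y ^ n) = (Y * X) * Y ^ n"
    by (simp only: mult.assoc)
  also have "\<dots> = X * Y ^ Suc n + Y ^ n"
    unfolding weyl_Y_X[where 'a = 'a, folded X_def Y_def] by (simp add: distrib_right mult.assoc)
  finally show ?case by (simp add: algebra_simps)
qed simp

section \<open>Modules over the Weyl algebra\<close>

text \<open>
  The universal property of the presentation: operators with \<open>y x = x y + 1\<close> make a vector space
  a module over the Weyl algebra.  It is used for \<open>A\<^sub>1 \<times> A\<^sub>1\<close>, which produces derivations, for \<open>R[z]\<close>,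
  which recovers normal forms, and for \<open>R\<close>, where \<open>y\<close> is \<open>d/dx\<close>.
\<close>
locale weyl_action =
  fixes scale :: "'a::field \<Rightarrow> 'm::ab_group_add \<Rightarrow> 'm" and x y :: "'m \<Rightarrow> 'm"
  assumes scale_add_left: "scale (c + d) m = scale c m + scale d m"
    and scale_add: "scale c (m + n) = scale c m + scale c n"
    and scale_scale: "scale c (scale d m) = scale (c * d) m"
    and scale_one: "scale 1 m = m"
    and x_add: "x (m + n) = x m + x n" and x_scale: "x (scale c m) = scale c (x m)"
    and y_add: "y (m + n) = y m + y n" and y_scale: "y (scale c m) = scale c (y m)"
    and y_x: "y (x m) = x (y m) + m"
begin

definition act_gen :: "gen \<Rightarrow> 'm \<Rightarrow> 'm" where
  "act_gen s = (case s of GX \<Rightarrow> x | GY \<Rightarrow> y)"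

definition act_word :: "word \<Rightarrow> 'm \<Rightarrow> 'm" where
  "act_word w m = foldr act_gen (letters w) m"

definition act_free :: "'a free_alg \<Rightarrow> 'm \<Rightarrow> 'm" where
  "act_free a m = (\<Sum>w\<in>Poly_Mapping.keys a. scale (Poly_Mapping.lookup a w) (act_word w m))"

lemma scale_0_left: "scale 0 m = 0"
  using scale_add_left[of 0 0 m] by simp

lemma act_word_add: "act_word w (m + n) = act_word w m + act_word w n"
proof -
  have "foldr act_gen l (m + n) = foldr act_gen l m + foldr act_gen l n" for l
    by (induction l) (simp_all add: act_gen_def x_add y_add split: gen.split)
  then show ?thesis by (simp add: act_word_def)
qed

lemma act_word_scale: "act_word w (scale c m) = scale c (act_word w m)"
proof -
  have "foldr act_gen l (scale c m) = scale c (foldr act_gen l m)" for l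
    by (induction l) (simp_all add: act_gen_def x_scale y_scale split: gen.split)
  then show ?thesis by (simp add: act_word_def)
qed

lemma act_word_plus: "act_word (u + v) m = act_word u (act_word v m)"
  by (simp add: act_word_def plus_word_def)

lemma act_free_superset:
  assumes "finite S" "Poly_Mapping.keys a \<subseteq> S"
  shows "act_free a m = (\<Sum>w\<in>S. scale (Poly_Mapping.lookup a w) (act_word w m))"
  unfolding act_free_def
  by (rule sum.mono_neutral_left) (use assms in \<open>auto simp: in_keys_iff scale_0_left\<close>)

lemma act_free_add: "act_free (a + b) m = act_free a m + act_free b m"
proof -
  let ?S = "Poly_Mapping.keys a \<union> Poly_Mapping.keys b"
  have "Poly_Mapping.keys (a + b) \<subseteq> ?S" by (rule keys_add)
  then show ?thesis
    by (simp add: act_free_superset[of ?S] lookup_add scale_add_left sum.distrib)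
qed

lemma act_free_single: "act_free (Poly_Mapping.single w c) m = scale c (act_word w m)"
  by (subst act_free_superset[of "{w}"]) auto

lemma act_free_0: "act_free 0 m = 0"
  by (simp add: act_free_def)

lemma act_free_add_right: "act_free a (m + n) = act_free a m + act_free a n"
  by (simp add: act_free_def act_word_add scale_add sum.distrib)

lemma act_free_0_right: "act_free a 0 = 0"
  using act_free_add_right[of a 0 0] by simp

lemma act_free_uminus: "act_free (- a) m = - act_free a m"
  using act_free_add[of a "- a" m] by (simp add: act_free_0 eq_neg_iff_add_eq_0 add.commute)

lemma act_free_diff: "act_free (a - b) m = act_free a m - act_free b m"
  using act_free_add[of a "- b" m] by (simp add: act_free_uminus)

lemma act_free_mult: "act_free (a * b) m = act_free a (act_free b m)"
proof (induction a rule: free_alg_induct)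
  case zero
  then show ?case by (simp add: act_free_0)
next
  case (add a a')
  then show ?case by (simp add: distrib_right act_free_add)
next
  case (single w c)
  show ?case
  proof (induction b rule: free_alg_induct)
    case zero
    then show ?case by (simp add: act_free_0 act_free_0_right)
  next
    case (single v d)
    then show ?case
      by (simp add: mult_single act_free_single act_word_plus act_word_scale scale_scale)
  next
    case (add b b')
    then show ?case by (simp add: distrib_left act_free_add act_free_add_right)
  qed
qed

lemma act_free_one: "act_free 1 m = m"
proof -
  have "act_free (Poly_Mapping.single 0 1) m = m"
    unfolding act_free_single by (simp add: act_word_def zero_word_def scale_one)
  then show ?thesis by simp
qed

lemma act_free_gen: "act_free (free_gen s) m = act_gen s m"
  by (simp add: free_gen_def act_free_single act_word_def scale_one)

lemma act_free_ideal: "a \<in> weyl_ideal \<Longrightarrow> act_free a m = 0"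
proof (induction arbitrary: m rule: weyl_ideal.induct)
  case (relator a b)
  have "act_free weyl_relator n = 0" for n
    by (simp add: weyl_relator_def act_free_diff act_free_mult act_free_gen act_free_one
        act_gen_def y_x)
  then show ?case by (simp add: act_free_mult act_free_0_right)
qed (simp_all add: act_free_0 act_free_add)

definition act :: "'a weyl \<Rightarrow> 'm \<Rightarrow> 'm" where
  "act a = act_free (rep_weyl a)"

lemma act_abs: "act (abs_weyl a) m = act_free a m"
proof -
  have "rep_weyl (abs_weyl a) - a \<in> weyl_ideal"
    using Quotient3_rep_abs[OF Quotient3_weyl, of a] by (simp add: weyl_ideal.zero)
  from act_free_ideal[OF this, of m] show ?thesis
    by (simp add: act_def act_free_diff)
qed

lemma act_X: "act weyl_X m = x m"
  by (simp add: weyl_X.abs_eq act_abs act_free_gen act_gen_def)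

lemma act_Y: "act weyl_Y m = y m"
  by (simp add: weyl_Y.abs_eq act_abs act_free_gen act_gen_def)

lemma act_const: "act (weyl_const c) m = scale c m"
  by (simp add: weyl_const.abs_eq act_abs act_free_single act_word_def zero_word_def)

lemma act_add: "act (a + b) m = act a m + act b m"
  by (induction a rule: weyl.abs_induct, induction b rule: weyl.abs_induct) (simp add: plus_weyl.abs_eq act_abs act_free_add)

lemma act_mult: "act (a * b) m = act a (act b m)"
  by (induction a rule: weyl.abs_induct, induction b rule: weyl.abs_induct) (simp add: times_weyl.abs_eq act_abs act_free_mult)

lemma act_0: "act 0 m = 0"
  using act_add[of 0 0 m] by simp

lemma act_sum: "act (\<Sum>i\<in>I. a i) m = (\<Sum>i\<in>I. act (a i) m)"
  by (induction I rule: infinite_finite_induct) (simp_all add: act_0 act_add)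

lemma act_uminus: "act (- a) m = - act a m"
  using act_add[of a "- a" m] by (simp add: act_0 eq_neg_iff_add_eq_0 add.commute)

end

section \<open>Derivations of the Weyl algebra\<close>

lemma derivation_on_1:
  assumes "derivation_on A D" "1 \<in> A"
  shows "D 1 = 0"
proof -
  have "D (1 * 1) = D 1 * 1 + 1 * D 1"
    using assms unfolding derivation_on_def by blast
  then show ?thesis by simp
qed

lemma derivation_on_const:
  assumes "derivation_on A D" "1 \<in> A"
  shows "D (weyl_const c) = 0"
proof -
  have "D (weyl_const c * 1) = weyl_const c * D 1"
    using assms unfolding derivation_on_def by blast
  then show ?thesis using derivation_on_1[OF assms] by simp
qed

text \<open>
  A derivation with prescribed values on \<open>x\<close> and \<open>y\<close> exists as soon as it respects the relation
  \<open>y x - x y = 1\<close>.  It is the lower left entry of the action of \<open>A\<^sub>1\<close> on \<open>A\<^sub>1 \<times> A\<^sub>1\<close> by triangular matrices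
  with equal diagonal entries; the compatibility condition says that the images of the two
  generators satisfy the relation.
\<close>
lemma weyl_derivation_exists:
  fixes u v :: "'a::field weyl"
  assumes compat: "commutator v weyl_X + commutator weyl_Y u = 0"
  shows "\<exists>D. derivation_on UNIV D \<and> D weyl_X = u \<and> D weyl_Y = v"
proof -
  define sc where "sc c m = (weyl_const c * fst m, weyl_const c * snd m)" for c and m :: "'a weyl \<times> 'a weyl"
  define X where "X m = (weyl_X * fst m, weyl_X * snd m + u * fst m)" for m
  define Y where "Y m = (weyl_Y * fst m, weyl_Y * snd m + v * fst m)" for m
  have central: "a * (weyl_const c * b) = weyl_const c * (a * b)" for a b :: "'a weyl" and c
    by (metis mult.assoc weyl_const_commute)
  interpret weyl_action sc X Y
  proof
    fix m :: "'a weyl \<times> 'a weyl"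
    have "weyl_Y * (weyl_X * snd m + u * fst m) + v * (weyl_X * fst m)
        = (weyl_Y * weyl_X) * snd m + (weyl_Y * u + v * weyl_X) * fst m"
      by (simp only: distrib_left distrib_right mult.assoc add.assoc)
    also have "weyl_Y * u + v * weyl_X = u * weyl_Y + weyl_X * v"
      using compat by (simp add: commutator_def algebra_simps)
    also have "(weyl_Y * weyl_X) * snd m + (u * weyl_Y + weyl_X * v) * fst m
        = (weyl_X * (weyl_Y * snd m + v * fst m) + u * (weyl_Y * fst m)) + snd m"
      unfolding weyl_Y_X by (simp add: algebra_simps)
    finally have "snd (Y (X m)) = snd (X (Y m) + m)"
      by (simp add: X_def Y_def)
    moreover have "fst (Y (X m)) = (weyl_Y * weyl_X) * fst m"
      by (simp add: X_def Y_def mult.assoc)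
    then have "fst (Y (X m)) = fst (X (Y m) + m)"
      unfolding weyl_Y_X by (simp add: X_def Y_def distrib_right mult.assoc)
    ultimately show "Y (X m) = X (Y m) + m"
      by (simp only: prod_eq_iff)
  qed (simp_all add: X_def Y_def sc_def central[of weyl_X] central[of weyl_Y] central[of u] central[of v]
      weyl_const_add weyl_const_mult
      distrib_left distrib_right mult.assoc add_ac)
  define D where "D a = snd (act a (1, 0))" for a
  have "\<exists>d. \<forall>m. act a m = (a * fst m, a * snd m + d * fst m)" for a
  proof (induction a rule: weyl_induct)
    case (const c)
    show ?case unfolding act_const by (rule exI[of _ 0]) (simp add: sc_def)
  next
    case X
    show ?case unfolding act_X by (rule exI[of _ u]) (simp add: X_def)
  next
    case Y
    show ?case unfolding act_Y by (rule exI[of _ v]) (simp add: Y_def)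
  next
    case (add a b)
    then obtain d d' where "\<And>m. act a m = (a * fst m, a * snd m + d * fst m)"
      "\<And>m. act b m = (b * fst m, b * snd m + d' * fst m)" by blast
    then show ?case
      by (intro exI[of _ "d + d'"]) (simp add: act_add distrib_right add_ac)
  next
    case (mult a b)
    then obtain d d' where "\<And>m. act a m = (a * fst m, a * snd m + d * fst m)"
      "\<And>m. act b m = (b * fst m, b * snd m + d' * fst m)" by blast
    then show ?case
      by (intro exI[of _ "a * d' + d * b"]) (simp add: act_mult distrib_left distrib_right mult.assoc add_ac)
  qed
  then have act: "act a m = (a * fst m, a * snd m + D a * fst m)" for a m
  proof -
    obtain d where d: "\<And>m. act a m = (a * fst m, a * snd m + d * fst m)"
      using \<open>\<And>a. \<exists>d. \<forall>m. act a m = (a * fst m, a * snd m + d * fst m)\<close> by blast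
    have "D a = d" by (simp add: D_def d)
    then show ?thesis by (simp add: d)
  qed
  have "D (weyl_const c) = 0" for c
    unfolding D_def act_const by (simp add: sc_def)
  moreover have "D (a * b) = D a * b + a * D b" for a b
  proof -
    have "D (a * b) = snd (act a (act b (1, 0)))" by (simp add: D_def act_mult)
    then show ?thesis by (simp add: act add.commute)
  qed
  moreover have "D (a + b) = D a + D b" for a b
    by (simp add: D_def act_add)
  ultimately have "derivation_on UNIV D"
    by (simp add: derivation_on_def)
  moreover have "D weyl_X = u" "D weyl_Y = v"
    unfolding D_def act_X act_Y by (simp_all add: X_def Y_def)
  ultimately show ?thesis by blast
qed

lemma weyl_derivation_unique:
  assumes D: "derivation_on UNIV D" and E: "derivation_on UNIV E"
    and "D weyl_X = E weyl_X" "D weyl_Y = E weyl_Y"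
  shows "D = E"
proof
  fix a
  show "D a = E a"
  proof (induction a rule: weyl_induct)
    case (const c)
    show ?case using derivation_on_const[OF D] derivation_on_const[OF E] by simp
  qed (use assms in \<open>simp_all add: derivation_on_def\<close>)
qed

section \<open>Normal forms and cancellation of polynomials\<close>

text \<open>
  On \<open>R[z]\<close>, let \<open>x\<close> act as multiplication by \<open>x\<close> and \<open>y\<close> as \<open>z + d/dx\<close>.  Then \<open>\<Sum> f\<^sub>k y\<^sup>k\<close> maps 1 to
  \<open>\<Sum> f\<^sub>k z\<^sup>k\<close>, so an element of \<open>A\<^sub>1\<close> can be recovered from its value at 1.
\<close>
definition symbol_X :: "'a::field poly poly \<Rightarrow> 'a poly poly" where
  "symbol_X m = smult [:0, 1:] m"

definition symbol_Y :: "'a::field poly poly \<Rightarrow> 'a poly poly" where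
  "symbol_Y m = pCons 0 m + map_poly pderiv m"

lemma coeff_symbol_Y:
  "coeff (symbol_Y m) n = (case n of 0 \<Rightarrow> 0 | Suc k \<Rightarrow> coeff m k) + pderiv (coeff m n)"
  by (simp add: symbol_Y_def coeff_map_poly coeff_pCons)

global_interpretation symbol: weyl_action "\<lambda>c. smult [:c:]" symbol_X symbol_Y
  defines symbol_act = symbol.act
proof
  fix c :: 'a and m n :: "'a poly poly"
  show "symbol_Y (m + n) = symbol_Y m + symbol_Y n"
    by (intro poly_eqI) (simp add: coeff_symbol_Y pderiv_add split: nat.split)
  show "symbol_Y (smult [:c:] m) = smult [:c:] (symbol_Y m)"
    by (intro poly_eqI) (simp add: coeff_symbol_Y pderiv_smult smult_add_right split: nat.split)
  show "symbol_Y (symbol_X m) = symbol_X (symbol_Y m) + m"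
    by (rule poly_eqI)
       (simp add: coeff_symbol_Y symbol_X_def pderiv_pCons algebra_simps split: nat.split)
  show "smult [:c + d:] m = smult [:c:] m + smult [:d:] m" for d
    by (simp flip: smult_add_left)
  show "smult [:1:] m = m" by (simp flip: one_pCons)
qed (simp_all add: symbol_X_def smult_add_right mult.commute)

definition normal_form :: "'a::field poly poly \<Rightarrow> 'a weyl" where
  "normal_form m = (\<Sum>k\<le>degree m. weyl_poly (coeff m k) * weyl_Y ^ k)"

lemma normal_form_superset:
  "degree m \<le> n \<Longrightarrow> normal_form m = (\<Sum>k\<le>n. weyl_poly (coeff m k) * weyl_Y ^ k)"
  unfolding normal_form_def
  by (rule sum.mono_neutral_left) (auto simp: coeff_eq_0)

lemma normal_form_add: "normal_form (m + n) = normal_form m + normal_form n"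
proof -
  let ?d = "max (degree m) (degree n)"
  have "degree (m + n) \<le> ?d" by (rule degree_add_le) auto
  then show ?thesis
    by (simp add: normal_form_superset[of _ ?d] weyl_poly_add distrib_right sum.distrib)
qed

lemma normal_form_smult: "normal_form (smult f m) = weyl_poly f * normal_form m"
  by (simp add: normal_form_superset[of _ "degree m"] degree_smult_le weyl_poly_mult
      sum_distrib_left mult.assoc)

lemma normal_form_Y: "normal_form (symbol_Y m) = weyl_Y * normal_form m"
proof -
  let ?n = "Suc (degree m)"
  have "degree (map_poly pderiv m) \<le> degree m"
    by (rule degree_le) (simp add: coeff_map_poly coeff_eq_0)
  then have "degree (symbol_Y m) \<le> ?n"
    unfolding symbol_Y_def by (intro degree_add_le degree_pCons_le) simp
  then have "normal_form (symbol_Y m) = (\<Sum>k\<le>?n. weyl_poly (coeff (symbol_Y m) k) * weyl_Y ^ k)"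
    by (rule normal_form_superset)
  also have "\<dots> = (\<Sum>k\<le>?n. weyl_poly (case k of 0 \<Rightarrow> 0 | Suc j \<Rightarrow> coeff m j) * weyl_Y ^ k)
      + (\<Sum>k\<le>?n. weyl_poly (pderiv (coeff m k)) * weyl_Y ^ k)"
    by (simp only: coeff_symbol_Y weyl_poly_add distrib_right sum.distrib)
  also have "(\<Sum>k\<le>?n. weyl_poly (case k of 0 \<Rightarrow> 0 | Suc j \<Rightarrow> coeff m j) * weyl_Y ^ k)
      = (\<Sum>k\<le>degree m. weyl_poly (coeff m k) * weyl_Y ^ Suc k)"
    by (subst sum.atMost_Suc_shift) simp
  also have "(\<Sum>k\<le>?n. weyl_poly (pderiv (coeff m k)) * weyl_Y ^ k)
      = (\<Sum>k\<le>degree m. weyl_poly (pderiv (coeff m k)) * weyl_Y ^ k)"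
    by (simp add: coeff_eq_0)
  also have "(\<Sum>k\<le>degree m. weyl_poly (coeff m k) * weyl_Y ^ Suc k) + \<dots> =
      (\<Sum>k\<le>degree m. weyl_Y * weyl_poly (coeff m k) * weyl_Y ^ k)"
    by (simp add: weyl_Y_poly distrib_right mult.assoc sum.distrib)
  also have "\<dots> = weyl_Y * normal_form m"
    by (simp add: normal_form_def sum_distrib_left mult.assoc)
  finally show ?thesis .
qed

lemma normal_form_act: "normal_form (symbol_act a m) = a * normal_form m"
proof (induction a arbitrary: m rule: weyl_induct)
  case (const c)
  then show ?case by (simp add: symbol.act_const normal_form_smult weyl_poly_const)
next
  case X
  then show ?case by (simp add: symbol.act_X symbol_X_def normal_form_smult weyl_poly_X)
next
  case Y
  then show ?case by (simp add: symbol.act_Y normal_form_Y)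
next
  case (add a b)
  then show ?case by (simp add: symbol.act_add normal_form_add distrib_right)
next
  case (mult a b)
  then show ?case by (simp add: symbol.act_mult mult.assoc)
qed

text \<open>
  So every element has a normal form and is determined by its value at 1.
\<close>
lemma normal_form_symbol: "normal_form (symbol_act a 1) = a"
  using normal_form_act[of a 1] by (simp add: normal_form_def)

lemma symbol_act_poly: "symbol_act (weyl_poly f) m = smult f m"
proof (induction f)
  case 0
  then show ?case by (simp add: symbol.act_0)
next
  case (pCons c f)
  then show ?case
    by (simp add: weyl_poly_pCons symbol.act_add symbol.act_const symbol.act_mult symbol.act_X
        symbol_X_def flip: smult_add_left)
qed

text \<open>
  A polynomial acts on \<open>R[z]\<close> as a scalar, and \<open>R[z]\<close> has no torsion over \<open>R\<close>.
\<close>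
lemma weyl_poly_mult_eq_0:
  assumes "weyl_poly f * a = 0" "f \<noteq> 0"
  shows "a = 0"
proof -
  have "smult f (symbol_act a 1) = 0"
    using arg_cong[OF assms(1), of "\<lambda>a. symbol_act a 1"]
    by (simp add: symbol.act_mult symbol.act_0 symbol_act_poly)
  then have "symbol_act a 1 = 0" using assms(2) by simp
  then show ?thesis using normal_form_symbol[of a] by (simp add: normal_form_def)
qed

lemma weyl_poly_mult_cancel:
  assumes "weyl_poly f * a = weyl_poly f * b" "f \<noteq> 0"
  shows "a = b"
  using weyl_poly_mult_eq_0[of f "a - b"] assms by (simp add: right_diff_distrib)

section \<open>Arithmetic in characteristic \<open>p\<close> and the operator \<open>\<partial>\<^sub>p\<close>\<close>

context
  fixes p :: nat
  assumes char_p: "CHAR('a::field) = p" and p_pos: "p > 0"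
begin

lemma prime_p: "prime p"
  using prime_CHAR_semidom[where 'a = 'a] char_p p_pos by simp

lemma of_nat_eq_0_iff: "(of_nat n :: 'a) = 0 \<longleftrightarrow> p dvd n"
  using of_nat_eq_0_iff_char_dvd[where 'a = 'a] char_p by simp

lemma of_nat_p [simp]: "(of_nat p :: 'a) = 0"
  by (simp add: of_nat_eq_0_iff)

lemma of_nat_pred_choose:
  "j < p \<Longrightarrow> (of_nat ((p - 1) choose j) :: 'a) = (- 1) ^ j"
proof (induction j)
  case (Suc j)
  have "p dvd (p choose Suc j)"
    using Suc.prems p_pos prime_p by (intro dvd_choose_prime) auto
  moreover have "p choose Suc j = ((p - 1) choose j) + ((p - 1) choose Suc j)"
    using p_pos by (cases p) simp_all
  ultimately have "(of_nat ((p - 1) choose j) + of_nat ((p - 1) choose Suc j) :: 'a) = 0"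
    by (simp add: of_nat_eq_0_iff flip: of_nat_add)
  then show ?case using Suc by (simp add: add_eq_0_iff)
qed simp

lemma of_nat_power_p: "(of_nat n :: 'a) ^ p = of_nat n"
proof (induction n)
  case 0
  then show ?case using p_pos by simp
next
  case (Suc n)
  have "(1 + of_nat n :: 'a) ^ p = 1 ^ p + of_nat n ^ p"
    by (rule freshmans_dream) (use char_p prime_p in simp_all)
  then show ?case using Suc by simp
qed

lemma of_nat_power_pred: "(of_nat n :: 'a) ^ (p - 1) = (if p dvd n then 0 else 1)"
proof (cases "p dvd n")
  case True
  then show ?thesis using prime_gt_1_nat[OF prime_p] by (simp flip: of_nat_eq_0_iff)
next
  case False
  have "(of_nat n :: 'a) * of_nat n ^ (p - 1) = of_nat n * 1"
    using of_nat_power_p[of n] p_pos by (simp flip: power_Suc)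
  then show ?thesis using False by (simp add: of_nat_eq_0_iff)
qed

text \<open>
  By Fermat's little theorem, \<open>(X+1) \<cdots> (X+p-1) = X\<^bsup>p-1\<^esup> - 1\<close>, since both sides are monic with the
  roots \<open>1, \<dots>, p-1\<close>.  This is its value at \<open>X = n\<close>; the value at 0 is Wilson's theorem.
\<close>
lemma pochhammer_pred:
  "pochhammer (of_nat (Suc n) :: 'a) (p - 1) = (if p dvd n then - 1 else 0)"
proof -
  define Q :: "'a poly" where "Q = (\<Prod>i<p-1. [:of_nat (Suc i), 1:])"
  have degQ: "degree Q = p - 1"
    unfolding Q_def by (subst degree_prod_eq_sum_degree) auto
  have "lead_coeff Q = 1"
    unfolding Q_def lead_coeff_prod by simp
  have card: "card ((of_nat :: nat \<Rightarrow> 'a) ` {1..p-1}) = p - 1"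
  proof (subst card_image)
    show "inj_on (of_nat :: nat \<Rightarrow> 'a) {1..p-1}"
    proof (rule linorder_inj_onI)
      fix i j assume ij: "i < j" "i \<in> {1..p-1}" "j \<in> {1..p-1}"
      then have "\<not> p dvd (j - i)"
        by (auto dest!: dvd_imp_le)
      then show "(of_nat i :: 'a) \<noteq> of_nat j"
        using ij by (metis of_nat_eq_0_iff of_nat_diff less_imp_le right_minus_eq)
    qed (auto simp: nat_le_linear)
  qed simp
  have "Q = monom 1 (p - 1) - 1"
  proof (rule poly_eqI_degree_lead_coeff)
    show "coeff Q (p - 1) = coeff (monom 1 (p - 1) - 1) (p - 1)"
      using \<open>lead_coeff Q = 1\<close> degQ prime_gt_1_nat[OF prime_p] by simp
    show "degree (monom 1 (p - 1) - 1 :: 'a poly) \<le> p - 1"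
      by (intro degree_diff_le) (simp_all add: degree_monom_le)
    fix z :: 'a assume "z \<in> of_nat ` {1..p-1}"
    then obtain i where i: "i \<in> {1..p-1}" "z = of_nat i" by blast
    \<comment> \<open>the factor with index \<open>p - i - 1\<close> vanishes at \<open>i\<close>\<close>
    have "Suc (p - i - 1) + i = p" using i by auto
    then have 0: "(of_nat (Suc (p - i - 1)) + of_nat i :: 'a) = 0"
      by (metis of_nat_add of_nat_p)
    then have "poly Q z = 0"
      using i unfolding Q_def poly_prod
      by (intro prod_zero bexI[of _ "p - i - 1"]) (use 0 in \<open>auto simp del: of_nat_Suc\<close>)
    moreover have "\<not> p dvd i" using i p_pos by (auto dest!: dvd_imp_le)
    then have "poly (monom 1 (p - 1) - 1) z = 0"
      using i of_nat_power_pred[of i] by (simp add: poly_monom)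
    ultimately show "poly Q z = poly (monom 1 (p - 1) - 1) z" by simp
  qed (use card degQ in simp_all)
  then have "poly Q (of_nat n) = of_nat n ^ (p - 1) - 1"
    by (simp add: poly_monom)
  moreover have "poly Q (of_nat n) = pochhammer (of_nat (Suc n)) (p - 1)"
    unfolding Q_def poly_prod pochhammer_prod by (intro prod.cong) (auto simp: atLeast0LessThan)
  ultimately have "pochhammer (of_nat (Suc n) :: 'a) (p - 1) = of_nat n ^ (p - 1) - 1"
    by simp
  then show ?thesis unfolding of_nat_power_pred by simp
qed

lemma pderiv_power_p [simp]: "pderiv (f ^ p) = 0" for f :: "'a poly"
  using pderiv_power[of f p] by (simp add: of_nat_poly)

lemma coeff_pcompose_monom_p:
  "coeff (pcompose f (monom 1 p)) n = (if p dvd n then coeff f (n div p) else 0)" for f :: "'a poly"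
proof (induction f arbitrary: n)
  case (pCons c f)
  have "coeff (pcompose (pCons c f) (monom 1 p)) n =
      (if n = 0 then c else 0) + (if n < p then 0 else coeff (pcompose f (monom 1 p)) (n - p))"
    by (simp add: pcompose_pCons coeff_monom_mult coeff_pCons split: nat.split)
  also have "\<dots> = (if p dvd n then coeff (pCons c f) (n div p) else 0)"
  proof (cases "n < p")
    case True
    then show ?thesis by (auto dest!: dvd_imp_le)
  next
    case False
    then have "n div p = Suc ((n - p) div p)" "p dvd n \<longleftrightarrow> p dvd (n - p)"
      using p_pos by (simp_all add: le_div_geq dvd_minus_self)
    then show ?thesis using False p_pos pCons.IH by simp
  qed
  finally show ?case .
qed simp

lemma coeff_xp_part: "coeff (xp_part f i) m = coeff f (p * m + i)" for f :: "'a poly"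
proof -
  have "coeff (xp_part f i) m = (\<Sum>k\<le>degree f. if k = m then coeff f (p * k + i) else 0)"
    by (simp add: xp_part_def coeff_sum char_p)
  also have "\<dots> = (if m \<le> degree f then coeff f (p * m + i) else 0)"
    by (simp add: sum.delta')
  also have "\<dots> = coeff f (p * m + i)"
  proof -
    have "m \<le> p * m" using p_pos by simp
    then have "coeff f (p * m + i) = 0" if "degree f < m"
      using that by (intro coeff_eq_0) linarith
    then show ?thesis by auto
  qed
  finally show ?thesis .
qed

text \<open>
  The factor is \<open>(n + p) choose p\<close> modulo \<open>p\<close>, so \<open>\<partial>\<^sub>p\<close> is the \<open>p\<close>-th Hasse derivative.
\<close>
lemma coeff_partial_p: "coeff (partial_p f) n = of_nat (Suc (n div p)) * coeff f (n + p)"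
  for f :: "'a poly"
proof -
  let ?q = "\<lambda>i. pcompose (pderiv (xp_part f i)) (monom 1 p)"
  have *: "coeff (?q i * monom 1 i) n = (if i = n mod p then of_nat (Suc (n div p)) * coeff f (n + p) else 0)"
    if "i < p" for i
  proof -
    have "coeff (?q i * monom 1 i) n = (if n < i then 0 else coeff (?q i) (n - i))"
      by (simp add: mult.commute[of _ "monom 1 i"] coeff_monom_mult)
    also have "\<dots> = (if i = n mod p then of_nat (Suc (n div p)) * coeff f (n + p) else 0)"
    proof (cases "i = n mod p")
      case True
      have n: "n = p * (n div p) + i" using True by simp
      then have ni: "n - i = p * (n div p)" "\<not> n < i" by linarith+
      then have "(n - i) div p = n div p" "p dvd n - i"
        using p_pos by simp_all
      moreover have "p * Suc (n div p) + i = n + p" using n by simp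
      ultimately show ?thesis using True ni(2)
        by (simp add: coeff_pcompose_monom_p coeff_pderiv coeff_xp_part del: mult_Suc_right)
    next
      case False
      have "\<not> p dvd n - i" if "\<not> n < i"
      proof
        assume "p dvd n - i"
        then obtain k where "n - i = p * k" ..
        then have "n = p * k + i" using that by linarith
        then show False using False \<open>i < p\<close> by simp
      qed
      then show ?thesis using False by (simp add: coeff_pcompose_monom_p)
    qed
    finally show ?thesis .
  qed
  have "coeff (partial_p f) n = (\<Sum>i<p. coeff (?q i * monom 1 i) n)"
    by (simp add: partial_p_def coeff_sum char_p)
  also have "\<dots> = (\<Sum>i<p. if i = n mod p then of_nat (Suc (n div p)) * coeff f (n + p) else 0)"
    by (intro sum.cong) (use * in auto)
  also have "\<dots> = of_nat (Suc (n div p)) * coeff f (n + p)"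
    using p_pos by simp
  finally show ?thesis .
qed

text \<open>
  The Leibniz rule \<open>H\<^sub>p(x f) = x H\<^sub>p(f) + H\<^bsub>p-1\<^esub>(f)\<close> of the Hasse derivatives; the \<open>(p-1)\<close>-st one is the
  \<open>(p-1)\<close>-fold derivative divided by \<open>(p-1)! = -1\<close>.
\<close>
lemma partial_p_pCons:
  "partial_p (pCons c f) = [:0, 1:] * partial_p f - (pderiv ^^ (p - 1)) f" for f :: "'a poly"
proof (rule poly_eqI)
  fix n
  have rhs: "coeff ([:0, 1:] * partial_p f - (pderiv ^^ (p - 1)) f) n =
      (case n of 0 \<Rightarrow> 0 | Suc k \<Rightarrow> of_nat (Suc (k div p)) * coeff f (k + p))
      - (if p dvd n then - 1 else 0) * coeff f (n + (p - 1))"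
    unfolding coeff_diff coeff_higher_pderiv pochhammer_pred
    by (simp add: coeff_pCons coeff_partial_p split: nat.split)
  have np: "coeff (pCons c f) (n + p) = coeff f (n + (p - 1))"
    using p_pos by (cases p) (simp_all add: coeff_pCons)
  show "coeff (partial_p (pCons c f)) n = coeff ([:0, 1:] * partial_p f - (pderiv ^^ (p - 1)) f) n"
  proof (cases n)
    case 0
    then show ?thesis unfolding rhs coeff_partial_p np by simp
  next
    case (Suc k)
    have "k + p = n + (p - 1)" using Suc p_pos by simp
    moreover have "Suc k div p = (if p dvd Suc k then Suc (k div p) else k div p)"
      by (simp add: div_Suc dvd_eq_mod_eq_0)
    ultimately show ?thesis unfolding rhs coeff_partial_p np using Suc
      by (simp add: distrib_right)
  qed
qed

end

section \<open>Derivations on polynomials and on powers of \<open>y\<close>\<close>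

lemma derivation_add: "derivation_on UNIV D \<Longrightarrow> D (a + b) = D a + D b"
  and derivation_mult: "derivation_on UNIV D \<Longrightarrow> D (a * b) = D a * b + a * D b"
  by (simp_all add: derivation_on_def)

lemma derivation_const: "derivation_on UNIV D \<Longrightarrow> D (weyl_const c) = 0"
  using derivation_on_const[of UNIV D] by simp

lemma derivation_poly_eq_0:
  assumes "derivation_on UNIV D" "D weyl_X = 0"
  shows "D (weyl_poly f) = 0"
proof (induction f)
  case 0
  then show ?case using derivation_const[OF assms(1), of 0] by simp
next
  case (pCons c f)
  then show ?case using assms
    by (simp add: weyl_poly_pCons derivation_add derivation_mult derivation_const)
qed

lemma higher_pderiv_Suc_pCons:
  "(pderiv ^^ Suc k) (pCons c f) = pCons 0 ((pderiv ^^ Suc k) f) + smult (of_nat (Suc k)) ((pderiv ^^ k) f)"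
  for f :: "'a::idom poly"
proof (induction k)
  case (Suc k)
  have "(pderiv ^^ Suc (Suc k)) (pCons c f) = pderiv ((pderiv ^^ Suc k) (pCons c f))"
    by simp
  also have "\<dots> = pCons 0 ((pderiv ^^ Suc (Suc k)) f) + smult (1 + of_nat (Suc k)) ((pderiv ^^ Suc k) f)"
    unfolding Suc by (simp add: pderiv_add pderiv_pCons pderiv_smult smult_add_left del: of_nat_Suc)
  finally show ?case by (simp only: of_nat_Suc)
qed (simp add: pderiv_pCons)

lemma higher_pderiv_pderiv: "1 \<le> k \<Longrightarrow> (pderiv ^^ (k - 1)) (pderiv f) = (pderiv ^^ k) f"
  by (cases k) (simp_all add: funpow_swap1)

lemma of_nat_left_commute: "a * (of_nat n * b) = of_nat n * (a * b)" for a b :: "'b::ring_1"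
  by (simp add: mult_of_nat_commute[of n a] flip: mult.assoc)

text \<open>
  As \<open>(p choose k) / p\<close> is \<open>(-1)\<^bsup>k-1\<^esup> / k\<close> modulo \<open>p\<close>, this is \<open>[y\<^sup>p, F] / p\<close> for \<open>F' = f\<close>, without its last term, in
  which no \<open>y\<close> occurs.  It is meaningful also if \<open>f\<close> has no antiderivative.
\<close>
definition divided_comm :: "nat \<Rightarrow> 'a::field poly \<Rightarrow> 'a weyl" where
  "divided_comm p f = (\<Sum>k=1..p-1.
     weyl_poly (smult ((- 1) ^ (k - 1) / of_nat k) ((pderiv ^^ (k - 1)) f)) * weyl_Y ^ (p - k))"

lemma higher_pderiv_mult_const:
  "pderiv c = 0 \<Longrightarrow> (pderiv ^^ k) (c * f) = c * (pderiv ^^ k) f"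
  by (induction k) (simp_all add: pderiv_mult)

lemma weyl_poly_times_divided_comm:
  assumes "pderiv c = 0"
  shows "weyl_poly c * divided_comm p f = divided_comm p (c * f)"
  by (simp add: divided_comm_def sum_distrib_left higher_pderiv_mult_const[OF assms] weyl_poly_mult
      mult.assoc flip: mult_smult_right)

lemma commutator_Y_divided_comm:
  "commutator weyl_Y (divided_comm p f) = divided_comm p (pderiv f)"
proof -
  have "weyl_Y * (weyl_poly q * weyl_Y ^ n) - (weyl_poly q * weyl_Y ^ n) * weyl_Y
      = weyl_poly (pderiv q) * weyl_Y ^ n" for q :: "'a poly" and n
  proof -
    have "weyl_Y * (weyl_poly q * weyl_Y ^ n) = (weyl_Y * weyl_poly q) * weyl_Y ^ n"
      by (simp only: mult.assoc)
    then show ?thesis by (simp add: weyl_Y_poly distrib_right mult.assoc power_commutes)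
  qed
  then show ?thesis
    by (simp add: commutator_def divided_comm_def sum_distrib_left sum_distrib_right pderiv_smult
        funpow_swap1 flip: sum_subtractf)
qed

text \<open>
  The value at \<open>y\<^sup>n\<close> of every derivation that maps \<open>y\<close> to \<open>u\<close>, in normal form.
\<close>
definition Y_power_derivative :: "nat \<Rightarrow> 'a::field poly \<Rightarrow> 'a weyl" where
  "Y_power_derivative n u = (\<Sum>k<n. of_nat (n choose Suc k) * (weyl_poly ((pderiv ^^ k) u) * weyl_Y ^ (n - Suc k)))"

lemma derivation_Y_power:
  assumes D: "derivation_on UNIV D" "D weyl_Y = weyl_poly u"
  shows "D (weyl_Y ^ n) = Y_power_derivative n u"
proof (induction n)
  case 0
  then show ?case using derivation_const[OF D(1), of 1] by (simp add: Y_power_derivative_def)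
next
  case (Suc n)
  let ?t = "\<lambda>k. weyl_poly ((pderiv ^^ k) u) * weyl_Y ^ (n - k)"
  have *: "weyl_Y ^ (n - Suc k) * weyl_Y = weyl_Y ^ (n - k)" if "k < n" for k
    using that by (simp flip: power_Suc2 add: Suc_diff_Suc)
  have "D (weyl_Y ^ Suc n) = D (weyl_Y ^ n) * weyl_Y + weyl_Y ^ n * weyl_poly u"
    unfolding power_Suc2 by (simp add: derivation_mult[OF D(1)] D(2))
  also have "D (weyl_Y ^ n) * weyl_Y = (\<Sum>k<n. of_nat (n choose Suc k) * ?t k)"
    unfolding Suc Y_power_derivative_def sum_distrib_right
    by (intro sum.cong) (simp_all add: * mult.assoc)
  also have "\<dots> = (\<Sum>k<Suc n. of_nat (n choose Suc k) * ?t k)"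
    by (simp add: binomial_eq_0)
  also have "weyl_Y ^ n * weyl_poly u = (\<Sum>k<Suc n. of_nat (n choose k) * ?t k)"
    unfolding weyl_Y_power_poly lessThan_Suc_atMost ..
  also have "(\<Sum>k<Suc n. of_nat (n choose Suc k) * ?t k) + (\<Sum>k<Suc n. of_nat (n choose k) * ?t k)
      = Y_power_derivative (Suc n) u"
    unfolding Y_power_derivative_def sum.distrib[symmetric]
    by (intro sum.cong) (simp_all add: distrib_right add.commute)
  finally show ?case .
qed

section \<open>The derivation \<open>E\<^sub>x\<close> on polynomials\<close>

global_interpretation poly_action: weyl_action "smult :: 'a::field \<Rightarrow> _" "\<lambda>q. [:0, 1:] * q" pderiv
  defines poly_act = poly_action.act
  by standard (simp_all add: smult_add_left smult_add_right pderiv_add pderiv_smult pderiv_pCons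
      mult.commute algebra_simps)

lemma poly_act_poly: "poly_act (weyl_poly f) q = f * q"
  by (induction f)
     (simp_all add: weyl_poly_pCons poly_action.act_0 poly_action.act_add poly_action.act_const
      poly_action.act_mult poly_action.act_X)

lemma poly_act_Y_power: "poly_act (weyl_Y ^ n) q = (pderiv ^^ n) q"
proof (induction n)
  case 0
  show ?case using poly_action.act_const[of 1 q] by simp
qed (simp_all add: poly_action.act_mult poly_action.act_Y)

context
  fixes p :: nat
  assumes char_p: "CHAR('a::field) = p" and p_pos: "p > 0"
begin

lemmas p_facts = prime_p[OF char_p p_pos] of_nat_eq_0_iff[OF char_p p_pos]
  of_nat_pred_choose[OF char_p p_pos]

lemma of_nat_p_minus:
  assumes "k \<le> p"
  shows "(of_nat (p - k) :: 'a) = - of_nat k"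
  using of_nat_p[OF char_p p_pos] assms by (simp add: of_nat_diff)

lemma of_nat_nonzero: "k \<in> {1..p-1} \<Longrightarrow> (of_nat k :: 'a) \<noteq> 0"
  using p_facts(2) p_pos by (auto dest!: dvd_imp_le)

text \<open>
  If \<open>\<delta>\<close> is the derivation with \<open>x \<mapsto> 0\<close> and \<open>y \<mapsto> u\<close>, then, up to a polynomial, \<open>divided_comm p u\<close> is
  \<open>\<delta>(y\<^sup>p) / p\<close>; applying \<open>\<delta>\<close> to \<open>[y\<^sup>p, x] / p = y\<^bsup>p-1\<^esup>\<close> gives the claim.  Modulo \<open>p\<close> this is a
  comparison of coefficients, based on \<open>(p-1) choose k = (-1)\<^sup>k\<close>.
\<close>
lemma divided_comm_X:
  "commutator (divided_comm p u) weyl_X = Y_power_derivative (p - 1) u" for u :: "'a poly"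
proof -
  have "commutator (divided_comm p u) weyl_X = (\<Sum>k=1..p-1.
      weyl_poly (smult ((- 1) ^ (k - 1) / of_nat k) ((pderiv ^^ (k - 1)) u)) * (of_nat (p - k) * weyl_Y ^ (p - 1 - k)))"
  proof -
    have "(weyl_poly q * weyl_Y ^ n) * weyl_X - weyl_X * (weyl_poly q * weyl_Y ^ n)
        = weyl_poly q * (of_nat n * weyl_Y ^ (n - 1))" for q :: "'a poly" and n
    proof -
      have "weyl_X * (weyl_poly q * weyl_Y ^ n) = weyl_poly q * (weyl_X * weyl_Y ^ n)"
        using weyl_poly_commute[of "[:0, 1:]" q] by (simp add: weyl_poly_X flip: mult.assoc)
      then show ?thesis by (simp add: mult.assoc weyl_Y_power_X distrib_left)
    qed
    then show ?thesis
      by (simp add: commutator_def divided_comm_def sum_distrib_left sum_distrib_right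
          flip: sum_subtractf)
  qed
  also have "\<dots> = (\<Sum>k=1..p-1. of_nat ((p - 1) choose k) *
      (weyl_poly ((pderiv ^^ (k - 1)) u) * weyl_Y ^ (p - 1 - k)))"
  proof (intro sum.cong refl)
    fix k assume k: "k \<in> {1..p-1}"
    then obtain j where j: "k = Suc j" by (cases k) auto
    have c: "((- 1) ^ (k - 1) / of_nat k) * of_nat (p - k) = (of_nat ((p - 1) choose k) :: 'a)"
      using k of_nat_nonzero[OF k] of_nat_p_minus[of k] p_facts(3)[of k]
      by (auto simp: j simp del: of_nat_Suc of_nat_diff)
    have "weyl_poly (smult ((- 1) ^ (k - 1) / of_nat k) ((pderiv ^^ (k - 1)) u)) * (of_nat (p - k) * weyl_Y ^ (p - 1 - k))
       = weyl_const (((- 1) ^ (k - 1) / of_nat k) * of_nat (p - k)) * (weyl_poly ((pderiv ^^ (k - 1)) u) * weyl_Y ^ (p - 1 - k))"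
      unfolding weyl_poly_smult weyl_const_mult weyl_const_of_nat
      by (simp add: mult.assoc of_nat_left_commute)
    then show "weyl_poly (smult ((- 1) ^ (k - 1) / of_nat k) ((pderiv ^^ (k - 1)) u)) * (of_nat (p - k) * weyl_Y ^ (p - 1 - k))
       = of_nat ((p - 1) choose k) * (weyl_poly ((pderiv ^^ (k - 1)) u) * weyl_Y ^ (p - 1 - k))"
      unfolding c weyl_const_of_nat .
  qed
  also have "\<dots> = Y_power_derivative (p - 1) u"
    unfolding Y_power_derivative_def
    by (rule sum.reindex_bij_witness[of _ Suc "\<lambda>k. k - 1"]) auto
  finally show ?thesis .
qed

lemma E_x_derivation: "derivation_on UNIV (E_x :: 'a weyl \<Rightarrow> 'a weyl)"
  and E_x_X: "E_x (weyl_X :: 'a weyl) = weyl_Y ^ (p - 1)"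
  and E_x_Y: "E_x (weyl_Y :: 'a weyl) = 0"
proof -
  let ?P = "\<lambda>E :: 'a weyl \<Rightarrow> 'a weyl.
    derivation_on UNIV E \<and> E weyl_X = weyl_Y ^ (p - 1) \<and> E weyl_Y = 0"
  have "\<exists>E. ?P E"
    by (rule weyl_derivation_exists) (simp add: commutator_def power_commutes)
  then have "\<exists>!E. ?P E"
    using weyl_derivation_unique by (metis (no_types, lifting))
  then have "?P (THE E. ?P E)" by (rule theI')
  then have "?P E_x" by (simp add: E_x_def char_p)
  then show "derivation_on UNIV (E_x :: 'a weyl \<Rightarrow> 'a weyl)"
    "E_x (weyl_X :: 'a weyl) = weyl_Y ^ (p - 1)" "E_x (weyl_Y :: 'a weyl) = 0" by blast+
qed

text \<open>
  Induction on \<open>f\<close>, with \<open>E\<^sub>x(x f) = y\<^bsup>p-1\<^esup> f + x E\<^sub>x(f)\<close>.  All terms of \<open>y\<^bsup>p-1\<^esup> f\<close> are accounted for by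
  the Leibniz rule for \<open>(x f)\<^bsup>(k)\<^esup>\<close>, except \<open>f\<^bsup>(p-1)\<^esup>\<close>, which comes from the recursion of \<open>\<partial>\<^sub>p\<close>.
\<close>
lemma E_x_poly: "E_x (weyl_poly f) = divided_comm p (pderiv f) - weyl_poly (partial_p f)"
  for f :: "'a poly"
proof (induction f)
  case 0
  have "partial_p 0 = (0 :: 'a poly)"
    by (simp add: partial_p_def xp_part_def)
  then show ?case
    using derivation_const[OF E_x_derivation, of 0] by (simp add: divided_comm_def)
next
  case (pCons c f)
  let ?t = "\<lambda>k. weyl_poly (smult ((- 1) ^ k) ((pderiv ^^ k) f)) * weyl_Y ^ (p - 1 - k)"
  have sgn: "(- 1 :: 'a) ^ (p - 1) = 1"
    using p_facts(3)[of "p - 1"] p_pos by simp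
  have "weyl_Y ^ (p - 1) * weyl_poly f = (\<Sum>k\<le>p-1. ?t k)"
    unfolding weyl_Y_power_poly
    by (intro sum.cong) (use p_facts(3) p_pos in
        \<open>auto simp: weyl_poly_smult mult.assoc simp flip: weyl_const_of_nat\<close>)
  also have "\<dots> = (\<Sum>k<p-1. ?t k) + weyl_poly ((pderiv ^^ (p - 1)) f)"
    using sgn by (simp flip: lessThan_Suc_atMost)
  finally have Y: "weyl_Y ^ (p - 1) * weyl_poly f = (\<Sum>k<p-1. ?t k) + weyl_poly ((pderiv ^^ (p - 1)) f)" .
  have shift: "divided_comm p (pderiv q) = (\<Sum>k<p-1.
      weyl_poly (smult ((- 1) ^ k / of_nat (Suc k)) ((pderiv ^^ Suc k) q)) * weyl_Y ^ (p - 1 - k))"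
    for q :: "'a poly"
    unfolding divided_comm_def
    by (rule sum.reindex_bij_witness[of _ Suc "\<lambda>k. k - 1"]) (auto simp: higher_pderiv_pderiv[simplified])
  have "divided_comm p (pderiv (pCons c f)) = (\<Sum>k<p-1. weyl_X *
      (weyl_poly (smult ((- 1) ^ k / of_nat (Suc k)) ((pderiv ^^ Suc k) f)) * weyl_Y ^ (p - 1 - k)) + ?t k)"
    unfolding shift
  proof (intro sum.cong refl)
    fix k assume "k \<in> {..<p-1}"
    then have "Suc k \<in> {1..p-1}" by auto
    from of_nat_nonzero[OF this] have
      "smult ((- 1) ^ k / of_nat (Suc k)) ((pderiv ^^ Suc k) (pCons c f))
       = [:0, 1:] * smult ((- 1) ^ k / of_nat (Suc k)) ((pderiv ^^ Suc k) f) + smult ((- 1) ^ k) ((pderiv ^^ k) f)"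
      unfolding higher_pderiv_Suc_pCons by (simp add: smult_add_right del: of_nat_Suc funpow.simps)
    then show "weyl_poly (smult ((- 1) ^ k / of_nat (Suc k)) ((pderiv ^^ Suc k) (pCons c f))) * weyl_Y ^ (p - 1 - k)
      = weyl_X * (weyl_poly (smult ((- 1) ^ k / of_nat (Suc k)) ((pderiv ^^ Suc k) f)) * weyl_Y ^ (p - 1 - k)) + ?t k"
      by (simp only: weyl_poly_add weyl_poly_mult weyl_poly_X distrib_right mult.assoc)
  qed
  also have "\<dots> = weyl_X * divided_comm p (pderiv f) + (\<Sum>k<p-1. ?t k)"
    unfolding shift sum.distrib sum_distrib_left ..
  finally have T: "divided_comm p (pderiv (pCons c f)) = weyl_X * divided_comm p (pderiv f) + (\<Sum>k<p-1. ?t k)" .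
  have "E_x (weyl_poly (pCons c f)) = weyl_Y ^ (p - 1) * weyl_poly f
      + weyl_X * (divided_comm p (pderiv f) - weyl_poly (partial_p f))"
    by (simp add: weyl_poly_pCons derivation_add[OF E_x_derivation] derivation_mult[OF E_x_derivation]
        derivation_const[OF E_x_derivation] E_x_X pCons.IH)
  also have "\<dots> = divided_comm p (pderiv (pCons c f)) - weyl_poly (partial_p (pCons c f))"
    unfolding Y T partial_p_pCons[OF char_p p_pos] weyl_poly_diff weyl_poly_mult weyl_poly_X
    by (simp add: algebra_simps)
  finally show ?case .
qed

text \<open>
  Let \<open>y\<close> act on \<open>R\<close> as \<open>d/dx\<close>.  All terms of \<open>E\<^sub>x(f) + \<partial>\<^sub>p(f)\<close> end in a positive power of \<open>y\<close>, so \<open>E\<^sub>x(f)\<close>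
  maps 1 to \<open>- \<partial>\<^sub>p(f)\<close>.  The claim is the equation \<open>E\<^sub>x(f g) = E\<^sub>x(f) g + f E\<^sub>x(g)\<close> applied to 1.
\<close>
lemma partial_p_mult:
  "partial_p (f * g) = f * partial_p g + g * partial_p f
     - (\<Sum>k=1..p-1. smult ((- 1) ^ (k - 1) / of_nat k) ((pderiv ^^ k) f * (pderiv ^^ (p - k)) g))"
  for f g :: "'a poly"
proof -
  have act: "poly_act (E_x (weyl_poly f)) q
      = (\<Sum>k=1..p-1. smult ((- 1) ^ (k - 1) / of_nat k) ((pderiv ^^ k) f * (pderiv ^^ (p - k)) q)) - partial_p f * q"
    for f q :: "'a poly"
  proof -
    have "poly_act (divided_comm p (pderiv f)) q
        = (\<Sum>k=1..p-1. smult ((- 1) ^ (k - 1) / of_nat k) ((pderiv ^^ k) f * (pderiv ^^ (p - k)) q))"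
      unfolding divided_comm_def poly_action.act_sum
    proof (intro sum.cong refl)
      fix k assume "k \<in> {1..p-1}"
      then have "(pderiv ^^ (k - 1)) (pderiv f) = (pderiv ^^ k) f"
        by (simp add: higher_pderiv_pderiv[simplified])
      then show "poly_act (weyl_poly (smult ((- 1) ^ (k - 1) / of_nat k) ((pderiv ^^ (k - 1)) (pderiv f))) * weyl_Y ^ (p - k)) q
          = smult ((- 1) ^ (k - 1) / of_nat k) ((pderiv ^^ k) f * (pderiv ^^ (p - k)) q)"
        by (simp add: poly_action.act_mult poly_act_poly poly_act_Y_power)
    qed
    then show ?thesis
      unfolding E_x_poly diff_conv_add_uminus poly_action.act_add poly_action.act_uminus poly_act_poly
      by simp
  qed
  \<comment> \<open>\<open>p - k > 0\<close> derivatives annihilate 1\<close>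
  have act1: "poly_act (E_x (weyl_poly f)) 1 = - partial_p f" for f :: "'a poly"
  proof -
    have "(pderiv ^^ (p - k)) 1 = (0 :: 'a poly)" if "k \<in> {1..p-1}" for k
    proof -
      have "p - k = Suc (p - k - 1)" using that by auto
      then show ?thesis by (metis funpow_swap1 funpow.simps(2) comp_apply higher_pderiv_0 pderiv_1)
    qed
    then show ?thesis by (simp add: act)
  qed
  have "E_x (weyl_poly (f * g)) = E_x (weyl_poly f) * weyl_poly g + weyl_poly f * E_x (weyl_poly g)"
    by (simp add: weyl_poly_mult derivation_mult[OF E_x_derivation])
  then have "- partial_p (f * g) = poly_act (E_x (weyl_poly f)) g - f * partial_p g"
    using act1[of "f * g"]
    by (simp add: poly_action.act_add poly_action.act_mult poly_act_poly act1)
  then show ?thesis by (simp add: act algebra_simps)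
qed

end

section \<open>The polynomial \<open>\<rho>\<^sub>h\<close>\<close>

text \<open>
  A nonzero element of least degree in the ideal generated by \<open>r\<close> and \<open>s\<close> divides all elements of
  the ideal.
\<close>
lemma poly_bezout:
  fixes r s :: "'a::field poly"
  assumes "r \<noteq> 0"
  obtains d a b where "d dvd r" "d dvd s" "d = a * r + b * s" "d \<noteq> 0"
proof -
  let ?P = "\<lambda>d. d \<noteq> 0 \<and> (\<exists>a b. d = a * r + b * s)"
  have "r = 1 * r + 0 * s" by simp
  then have "?P r" using assms by blast
  then obtain d where d: "?P d" and least: "\<And>c. ?P c \<Longrightarrow> degree d \<le> degree c"
    using ex_has_least_nat[of ?P r degree] by blast
  then obtain a b where ab: "d = a * r + b * s" by blast
  have "d dvd c" if c: "c = a' * r + b' * s" for c a' b'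
  proof (rule ccontr)
    assume "\<not> d dvd c"
    then have nz: "c mod d \<noteq> 0" by (simp add: dvd_eq_mod_eq_0)
    define q where "q = c div d"
    have "c mod d = c - q * d" by (simp add: q_def minus_div_mult_eq_mod)
    also have "\<dots> = (a' - q * a) * r + (b' - q * b) * s"
      using c ab by (simp add: algebra_simps)
    finally have "?P (c mod d)" using nz by blast
    then have "degree d \<le> degree (c mod d)" by (rule least)
    moreover have "degree (c mod d) < degree d"
      using degree_mod_less[of d c] d nz by auto
    ultimately show False by simp
  qed
  from this[of r 1 0] this[of s 0 1] show ?thesis using d ab that by simp
qed

lemma polys_in_xp_mult: "a \<in> polys_in_xp \<Longrightarrow> b \<in> polys_in_xp \<Longrightarrow> a * b \<in> polys_in_xp"
  unfolding polys_in_xp_def by (auto simp flip: pcompose_mult)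

lemma polys_in_xp_smult: "a \<in> polys_in_xp \<Longrightarrow> smult c a \<in> polys_in_xp"
  unfolding polys_in_xp_def by (auto simp flip: pcompose_smult)

text \<open>
  Compared with \<open>r\<close>, the least common multiple of \<open>r\<close> and \<open>s\<close>, formed inside \<open>F[x\<^sup>p]\<close>, has no larger
  degree if it divides \<open>h\<close>.  It does divide \<open>h\<close>, because a Bezout identity in \<open>F[x\<^sup>p]\<close> is also one in
  \<open>F[x]\<close>.  Hence it is \<open>r\<close> up to a unit.
\<close>
lemma monic_divisor_dvd_maximal:
  fixes h r s :: "'a::field poly"
  assumes h: "h \<noteq> 0"
    and r: "r \<in> polys_in_xp" "lead_coeff r = 1" "r dvd h"
    and s: "s \<in> polys_in_xp" "s dvd h"
    and max: "\<And>t. t \<in> polys_in_xp \<Longrightarrow> lead_coeff t = 1 \<Longrightarrow> t dvd h \<Longrightarrow> degree t \<le> degree r"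
  shows "s dvd r"
proof -
  define \<phi> where "\<phi> f = pcompose f (monom 1 CHAR('a))" for f :: "'a poly"
  have \<phi>: "\<phi> (f * g) = \<phi> f * \<phi> g" "\<phi> (f + g) = \<phi> f + \<phi> g" "\<phi> 1 = 1" "\<phi> f \<in> polys_in_xp" for f g
    by (simp_all add: \<phi>_def pcompose_mult pcompose_add polys_in_xp_def pcompose_1)
  obtain r0 s0 where r0: "r = \<phi> r0" and s0: "s = \<phi> s0"
    using r(1) s(1) by (auto simp: polys_in_xp_def \<phi>_def)
  have "r0 \<noteq> 0" using r(2) r0 by (auto simp: \<phi>_def)
  then obtain d a b where d: "d dvd r0" "d dvd s0" "d = a * r0 + b * s0" "d \<noteq> 0"
    by (rule poly_bezout)
  from d(1,2) obtain r1 s1 where r1: "r0 = d * r1" and s1: "s0 = d * s1" by (auto elim!: dvdE)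
  have "d = a * (d * r1) + b * (d * s1)" by (rule d(3)[unfolded r1 s1])
  also have "\<dots> = d * (a * r1 + b * s1)" by (simp add: algebra_simps)
  finally have "d * 1 = d * (a * r1 + b * s1)" by simp
  then have "a * r1 + b * s1 = 1"
    using d(4) by (metis mult_left_cancel)
  from arg_cong[OF this, of \<phi>] have bez: "\<phi> a * \<phi> r1 + \<phi> b * \<phi> s1 = 1"
    by (simp add: \<phi>)
  from r(3) obtain u where u: "h = r * u" by (rule dvdE)
  from s(2) obtain v where v: "h = s * v" by (rule dvdE)
  have "\<phi> d \<noteq> 0" using r(2) by (auto simp: r0 r1 \<phi>)
  moreover have "\<phi> d * (\<phi> r1 * u) = \<phi> d * (\<phi> s1 * v)"
  proof -
    have "\<phi> d * (\<phi> r1 * u) = h"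
      unfolding u by (simp add: r0 r1 \<phi> mult.assoc)
    also have "h = \<phi> d * (\<phi> s1 * v)"
      unfolding v by (simp add: s0 s1 \<phi> mult.assoc)
    finally show ?thesis .
  qed
  ultimately have uv: "\<phi> r1 * u = \<phi> s1 * v"
    using mult_left_cancel by blast
  have "u = (\<phi> a * \<phi> r1 + \<phi> b * \<phi> s1) * u" by (simp add: bez)
  also have "\<dots> = \<phi> a * (\<phi> r1 * u) + \<phi> s1 * (\<phi> b * u)" by (simp add: algebra_simps)
  also have "\<dots> = \<phi> s1 * (\<phi> a * v + \<phi> b * u)"
    unfolding uv by (simp add: algebra_simps)
  finally have "\<phi> s1 dvd u" by (rule dvdI)
  then have dvd: "r * \<phi> s1 dvd h"
    unfolding u by (intro mult_dvd_mono dvd_refl)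
  then have nz: "r * \<phi> s1 \<noteq> 0" using h by auto
  \<comment> \<open>\<open>r \<phi>(s1)\<close> is the least common multiple; maximality of \<open>r\<close> speaks of monic polynomials\<close>
  let ?t = "smult (1 / lead_coeff (r * \<phi> s1)) (r * \<phi> s1)"
  have "degree ?t \<le> degree r"
  proof (rule max)
    show "?t \<in> polys_in_xp" by (intro polys_in_xp_smult polys_in_xp_mult r(1) \<phi>)
    show "lead_coeff ?t = 1" using nz by (simp add: lead_coeff_smult del: lead_coeff_mult)
    show "?t dvd h" using dvd nz by (simp add: smult_dvd_iff del: lead_coeff_mult)
  qed
  then have "degree (\<phi> s1) = 0"
    using nz by (simp add: degree_mult_eq)
  then have "is_unit (\<phi> s1)"
    using nz by (simp add: is_unit_iff_degree)
  moreover have "\<phi> d dvd r" by (simp add: r0 r1 \<phi>)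
  ultimately show "s dvd r"
    by (simp add: s0 s1 \<phi> mult_unit_dvd_iff)
qed

text \<open>
  The definite description in \<open>rho\<close> is legitimate: by \<open>monic_divisor_dvd_maximal\<close>, two divisors of
  maximal degree divide each other.
\<close>
lemma rho_props:
  fixes h :: "'a::field poly"
  assumes h: "h \<noteq> 0"
  shows "rho h \<in> polys_in_xp" "lead_coeff (rho h) = 1" "rho h dvd h"
proof -
  let ?Q = "\<lambda>r. r \<in> polys_in_xp \<and> lead_coeff r = 1 \<and> r dvd h"
  let ?P = "\<lambda>r. ?Q r \<and> (\<forall>s. ?Q s \<longrightarrow> degree s \<le> degree r)"
  have "1 \<in> (polys_in_xp :: 'a poly set)"
    unfolding polys_in_xp_def by (metis pcompose_1 rangeI)
  then have "?Q 1" by simp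
  moreover have "\<forall>s. ?Q s \<longrightarrow> degree s < Suc (degree h)"
    using h by (auto simp: less_Suc_eq_le dvd_imp_degree_le)
  ultimately have "\<exists>r. ?P r"
    by (rule ex_has_greatest_nat)
  moreover have "r = s" if r: "?P r" and s: "?P s" for r s
  proof -
    have "r dvd s" by (rule monic_divisor_dvd_maximal[OF h]) (use r s in auto)
    then obtain k where k: "s = r * k" by (rule dvdE)
    have "lead_coeff k = 1"
      using r s by (metis k lead_coeff_mult mult_1)
    moreover have "degree s = degree r" using r s by (meson le_antisym)
    moreover have "r \<noteq> 0" "k \<noteq> 0" using r s k by auto
    ultimately have "degree k = 0" "lead_coeff k = 1"
      by (simp_all add: k degree_mult_eq)
    then have "k = 1"
      by (metis degree_eq_zeroE lead_coeff_pCons(2) one_pCons)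
    then show ?thesis by (simp add: k)
  qed
  ultimately have "\<exists>!r. ?P r" by blast
  then have "?P (THE r. ?P r)" by (rule theI')
  then show "rho h \<in> polys_in_xp" "lead_coeff (rho h) = 1" "rho h dvd h"
    unfolding rho_def by blast+
qed

lemma pderiv_polys_in_xp: "r \<in> polys_in_xp \<Longrightarrow> pderiv r = 0" for r :: "'a::field poly"
  by (auto simp: polys_in_xp_def pderiv_pcompose pderiv_monom)

section \<open>The subalgebra \<open>A\<^sub>h\<close>\<close>

lemma A_sub_const: "weyl_const c \<in> A_sub h"
  and A_sub_X: "weyl_X \<in> A_sub h"
  and A_sub_y_hat: "y_hat h \<in> A_sub h"
  and A_sub_add: "a \<in> A_sub h \<Longrightarrow> b \<in> A_sub h \<Longrightarrow> a + b \<in> A_sub h"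
  and A_sub_mult: "a \<in> A_sub h \<Longrightarrow> b \<in> A_sub h \<Longrightarrow> a * b \<in> A_sub h"
  unfolding A_sub_def by (auto intro: subalgebra_gen.intros)

lemma A_sub_0: "0 \<in> A_sub h" and A_sub_1: "1 \<in> A_sub h"
  using A_sub_const[of 0 h] A_sub_const[of 1 h] by simp_all

lemma A_sub_uminus: "a \<in> A_sub h \<Longrightarrow> - a \<in> A_sub h"
  using A_sub_mult[OF A_sub_const[of "- 1"], of a] by (simp add: weyl_const_uminus)

lemma A_sub_diff: "a \<in> A_sub h \<Longrightarrow> b \<in> A_sub h \<Longrightarrow> a - b \<in> A_sub h"
  using A_sub_add[OF _ A_sub_uminus, of a h b] by simp

lemma A_sub_sum: "(\<And>i. i \<in> I \<Longrightarrow> f i \<in> A_sub h) \<Longrightarrow> sum f I \<in> A_sub h"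
  by (induction I rule: infinite_finite_induct) (auto intro: A_sub_0 A_sub_add)

lemma A_sub_poly: "weyl_poly f \<in> A_sub h"
  by (induction f) (auto simp: weyl_poly_pCons intro: A_sub_0 A_sub_const A_sub_X A_sub_add A_sub_mult)

lemma A_sub_induct [consumes 1, case_names const X y_hat add mult]:
  assumes "a \<in> A_sub h" "\<And>c. P (weyl_const c)" "P weyl_X" "P (y_hat h)"
    "\<And>a b. a \<in> A_sub h \<Longrightarrow> b \<in> A_sub h \<Longrightarrow> P a \<Longrightarrow> P b \<Longrightarrow> P (a + b)"
    "\<And>a b. a \<in> A_sub h \<Longrightarrow> b \<in> A_sub h \<Longrightarrow> P a \<Longrightarrow> P b \<Longrightarrow> P (a * b)"
  shows "P a"
  using assms(1) unfolding A_sub_def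
  by (induction rule: subalgebra_gen.induct) (use assms(2-) in \<open>auto simp: A_sub_def\<close>)

lemma power_dvd_pderiv:
  assumes "h ^ Suc m dvd f"
  shows "h ^ m dvd pderiv f"
proof -
  from assms obtain q where "f = h ^ Suc m * q" by (rule dvdE)
  then have "f = h ^ m * (h * q)" by (simp add: mult_ac)
  moreover have "h ^ m dvd h * q * pderiv (h ^ m)"
  proof (cases m)
    case (Suc n)
    show ?thesis unfolding Suc pderiv_power_Suc
      by (rule dvdI[of _ _ "smult (of_nat (Suc n)) (pderiv h * q)"]) (simp add: mult_ac)
  qed simp
  ultimately show ?thesis by (simp add: pderiv_mult)
qed

lemma weyl_Y_poly_left: "weyl_Y * (weyl_poly f * a) = weyl_poly f * (weyl_Y * a) + weyl_poly (pderiv f) * a"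
proof -
  have "weyl_Y * (weyl_poly f * a) = (weyl_Y * weyl_poly f) * a" by (simp only: mult.assoc)
  then show ?thesis by (simp add: weyl_Y_poly distrib_right mult.assoc)
qed

text \<open>
  Induction on \<open>m\<close>, with \<open>(y h) (f y\<^sup>m) = h f y\<^bsup>m+1\<^esup> + (h f)' y\<^sup>m\<close>: differentiation costs only one power
  of \<open>h\<close>.
\<close>
lemma A_sub_Y_power: "h ^ m dvd f \<Longrightarrow> weyl_poly f * weyl_Y ^ m \<in> A_sub h"
proof (induction m arbitrary: f)
  case 0
  then show ?case by (simp add: A_sub_poly)
next
  case (Suc m)
  from Suc.prems obtain q where "f = h ^ Suc m * q" by (rule dvdE)
  then have q: "f = h * (h ^ m * q)" by (simp add: mult_ac)
  have "y_hat h * (weyl_poly (h ^ m * q) * weyl_Y ^ m) = weyl_Y * (weyl_poly f * weyl_Y ^ m)"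
    unfolding q y_hat_def by (simp add: weyl_poly_mult mult.assoc)
  then have "weyl_poly f * weyl_Y ^ Suc m
      = y_hat h * (weyl_poly (h ^ m * q) * weyl_Y ^ m) - weyl_poly (pderiv f) * weyl_Y ^ m"
    by (simp add: weyl_Y_poly_left)
  then show ?case
    using Suc.IH[of "h ^ m * q"] Suc.IH[of "pderiv f"] power_dvd_pderiv[OF Suc.prems]
    by (simp add: A_sub_diff A_sub_mult A_sub_y_hat)
qed

lemma A_sub_Y_times: "h ^ Suc m dvd f \<Longrightarrow> weyl_Y * (weyl_poly f * weyl_Y ^ m) \<in> A_sub h"
  using A_sub_Y_power[of h "Suc m" f] A_sub_Y_power[of h m "pderiv f"] power_dvd_pderiv[of h m f]
  by (simp add: weyl_Y_poly_left A_sub_add)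

lemma weyl_poly_central:
  assumes "pderiv c = 0"
  shows "weyl_poly c * a = a * weyl_poly c"
proof (induction a rule: weyl_induct)
  case (const d)
  then show ?case by (simp add: weyl_const_commute)
next
  case X
  then show ?case using weyl_poly_commute[of c "[:0, 1:]"] by (simp add: weyl_poly_X)
next
  case Y
  then show ?case by (simp add: weyl_Y_poly assms)
next
  case (add a b)
  then show ?case by (simp add: distrib_left distrib_right)
next
  case (mult a b)
  then show ?case by (metis mult.assoc)
qed

section \<open>The derivations \<open>D\<^sub>g\<close>\<close>

definition vertical_derivation :: "'a::field poly \<Rightarrow> 'a weyl \<Rightarrow> 'a weyl" where
  "vertical_derivation u = (SOME D. derivation_on UNIV D \<and> D weyl_X = 0 \<and> D weyl_Y = weyl_poly u)"

lemma vertical_derivation: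
  shows "derivation_on UNIV (vertical_derivation u)"
    and "vertical_derivation u weyl_X = 0"
    and "vertical_derivation u weyl_Y = weyl_poly u"
proof -
  have "\<exists>D. derivation_on UNIV D \<and> D weyl_X = 0 \<and> D weyl_Y = weyl_poly u"
    by (rule weyl_derivation_exists)
       (use weyl_poly_commute[of u "[:0, 1:]"] in \<open>simp add: commutator_def weyl_poly_X\<close>)
  from someI_ex[OF this] show "derivation_on UNIV (vertical_derivation u)"
    "vertical_derivation u weyl_X = 0" "vertical_derivation u weyl_Y = weyl_poly u"
    unfolding vertical_derivation_def by blast+
qed

lemma derivation_on_A_sub_eq:
  assumes D: "derivation_on (A_sub h) D" and E: "derivation_on (A_sub h) E"
    and "D weyl_X = E weyl_X" "D (y_hat h) = E (y_hat h)" and "a \<in> A_sub h"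
  shows "D a = E a"
  using assms(5)
proof (induction rule: A_sub_induct)
  case (const c)
  then show ?case using derivation_on_const[OF D A_sub_1] derivation_on_const[OF E A_sub_1] by simp
qed (use assms in \<open>simp_all add: derivation_on_def\<close>)

lemma D_der_eqI:
  assumes "D \<in> extensional (A_sub h)" "derivation_on (A_sub h) D" "D weyl_X = 0" "D (y_hat h) = e"
  shows "D_der h e = D"
  unfolding D_der_def
proof (rule the_equality)
  fix E
  assume E: "E \<in> extensional (A_sub h) \<and> derivation_on (A_sub h) E \<and> E weyl_X = 0 \<and> E (y_hat h) = e"
  show "E = D"
    by (rule extensionalityI[of _ "A_sub h"]) (use E assms derivation_on_A_sub_eq[of h E D] in auto)
qed (use assms in blast)

context
  fixes p :: nat and h :: "'a::field poly"
  assumes char_p: "CHAR('a) = p" and p_pos: "p > 0" and h: "h \<noteq> 0"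
begin

lemma h_power_central: "weyl_poly (h ^ p) * a = a * weyl_poly (h ^ p)"
  by (rule weyl_poly_central) (rule pderiv_power_p[OF char_p p_pos])

lemma h_power_cancel: "weyl_poly (h ^ p) * a = weyl_poly (h ^ p) * b \<Longrightarrow> a = b"
  using weyl_poly_mult_cancel[of "h ^ p" a b] h by simp

text \<open>
  On \<open>A\<^sub>1\<close>, the derivation with \<open>x \<mapsto> 0\<close> and \<open>y \<mapsto> g h\<^bsup>p-1\<^esup>\<close> maps \<open>y h\<close> to \<open>h\<^sup>p g\<close>, so it maps \<open>A\<^sub>h\<close> into
  \<open>h\<^sup>p A\<^sub>h\<close>.  Dividing by the central element \<open>h\<^sup>p\<close> leaves a derivation of \<open>A\<^sub>h\<close>, which is \<open>D\<^sub>g\<close>.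
\<close>
lemma D_der_props:
  defines "\<delta> \<equiv> \<lambda>g. vertical_derivation (g * h ^ (p - 1))"
  shows "derivation_on (A_sub h) (D_der h (weyl_poly g))"
    and "D_der h (weyl_poly g) weyl_X = 0"
    and "D_der h (weyl_poly g) (y_hat h) = weyl_poly g"
    and "a \<in> A_sub h \<Longrightarrow> weyl_poly (h ^ p) * D_der h (weyl_poly g) a = \<delta> g a"
proof -
  have \<delta>: "derivation_on UNIV (\<delta> g)"
    by (simp add: \<delta>_def vertical_derivation)
  have \<delta>_X: "\<delta> g weyl_X = 0" and \<delta>_Y: "\<delta> g weyl_Y = weyl_poly (g * h ^ (p - 1))"
    by (simp_all add: \<delta>_def vertical_derivation)
  have \<delta>_y_hat: "\<delta> g (y_hat h) = weyl_poly (h ^ p) * weyl_poly g"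
  proof -
    have "g * h ^ (p - 1) * h = h ^ p * g" using p_pos by (simp add: mult_ac flip: power_Suc)
    moreover have "\<delta> g (y_hat h) = weyl_poly (g * h ^ (p - 1)) * weyl_poly h"
      by (simp add: y_hat_def derivation_mult[OF \<delta>] \<delta>_Y derivation_poly_eq_0[OF \<delta> \<delta>_X])
    ultimately show ?thesis by (simp only: flip: weyl_poly_mult)
  qed
  have ex: "\<exists>b\<in>A_sub h. weyl_poly (h ^ p) * b = \<delta> g a" if "a \<in> A_sub h" for a
    using that
  proof (induction rule: A_sub_induct)
    case (const c)
    then show ?case by (intro bexI[OF _ A_sub_0]) (simp add: derivation_const[OF \<delta>])
  next
    case X
    then show ?case by (intro bexI[OF _ A_sub_0]) (simp add: \<delta>_X)
  next
    case y_hat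
    then show ?case by (intro bexI[OF _ A_sub_poly[of g]]) (simp add: \<delta>_y_hat)
  next
    case (add a b)
    then obtain a' b' where "a' \<in> A_sub h" "weyl_poly (h ^ p) * a' = \<delta> g a"
      "b' \<in> A_sub h" "weyl_poly (h ^ p) * b' = \<delta> g b" by blast
    then show ?case
      by (intro bexI[of _ "a' + b'"]) (simp_all add: A_sub_add derivation_add[OF \<delta>] distrib_left)
  next
    case (mult a b)
    then obtain a' b' where *: "a' \<in> A_sub h" "weyl_poly (h ^ p) * a' = \<delta> g a"
      "b' \<in> A_sub h" "weyl_poly (h ^ p) * b' = \<delta> g b" by blast
    have "weyl_poly (h ^ p) * (a' * b + a * b') = (weyl_poly (h ^ p) * a') * b + a * (weyl_poly (h ^ p) * b')"
      by (simp add: distrib_left h_power_central mult.assoc)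
    then show ?case using * mult.hyps
      by (intro bexI[of _ "a' * b + a * b'"]) (simp_all add: A_sub_add A_sub_mult derivation_mult[OF \<delta>])
  qed
  define D where "D = restrict (\<lambda>a. THE b. weyl_poly (h ^ p) * b = \<delta> g a) (A_sub h)"
  have D: "D a \<in> A_sub h \<and> weyl_poly (h ^ p) * D a = \<delta> g a" if "a \<in> A_sub h" for a
  proof -
    from ex[OF that] obtain b where "b \<in> A_sub h" "weyl_poly (h ^ p) * b = \<delta> g a" by blast
    moreover from this have "D a = b"
      using that h_power_cancel by (auto simp: D_def intro!: the_equality)
    ultimately show ?thesis by simp
  qed
  have D_eq: "D a = b" if "a \<in> A_sub h" "weyl_poly (h ^ p) * b = \<delta> g a" for a b
    by (rule h_power_cancel) (simp add: D that)
  have der: "derivation_on (A_sub h) D"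
    unfolding derivation_on_def
  proof (intro conjI ballI allI)
    show "D \<in> A_sub h \<rightarrow> A_sub h" using D by blast
    fix a assume a: "a \<in> A_sub h"
    show "D (weyl_const c * a) = weyl_const c * D a" for c
    proof (rule D_eq)
      have "weyl_poly (h ^ p) * (weyl_const c * D a) = weyl_const c * (weyl_poly (h ^ p) * D a)"
        by (metis mult.assoc weyl_const_commute)
      then show "weyl_poly (h ^ p) * (weyl_const c * D a) = \<delta> g (weyl_const c * a)"
        by (simp add: D[OF a] derivation_mult[OF \<delta>] derivation_const[OF \<delta>])
    qed (intro A_sub_mult A_sub_const a)
    fix b assume b: "b \<in> A_sub h"
    show "D (a + b) = D a + D b"
      by (rule D_eq) (simp_all add: A_sub_add a b distrib_left D derivation_add[OF \<delta>])
    show "D (a * b) = D a * b + a * D b"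
    proof (rule D_eq)
      have "weyl_poly (h ^ p) * (D a * b + a * D b) = (weyl_poly (h ^ p) * D a) * b + a * (weyl_poly (h ^ p) * D b)"
        by (simp add: distrib_left h_power_central mult.assoc)
      then show "weyl_poly (h ^ p) * (D a * b + a * D b) = \<delta> g (a * b)"
        by (simp add: D a b derivation_mult[OF \<delta>])
    qed (intro A_sub_mult a b)
  qed
  have X: "D weyl_X = 0"
    by (rule D_eq) (simp_all add: A_sub_X \<delta>_X)
  have y: "D (y_hat h) = weyl_poly g"
    by (rule D_eq) (simp_all add: A_sub_y_hat \<delta>_y_hat)
  have "D_der h (weyl_poly g) = D"
    by (rule D_der_eqI) (use der X y in \<open>simp_all add: D_def\<close>)
  then show "derivation_on (A_sub h) (D_der h (weyl_poly g))"
    "D_der h (weyl_poly g) weyl_X = 0" "D_der h (weyl_poly g) (y_hat h) = weyl_poly g"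
    "a \<in> A_sub h \<Longrightarrow> weyl_poly (h ^ p) * D_der h (weyl_poly g) a = \<delta> g a"
    using der X y D by simp_all
qed

end

section \<open>Rational functions with constant denominator\<close>

lemma poly_fract_inject: "poly_fract f = poly_fract g \<longleftrightarrow> f = g"
  by (simp add: eq_fract)

lemma weyl_fract_quotient:
  assumes "c \<noteq> 0" "a = q * c"
  shows "weyl_fract (poly_fract a / poly_fract c) = weyl_poly q"
proof -
  have "poly_fract a / poly_fract c = poly_fract q"
    using assms by (simp add: eq_fract)
  then show ?thesis
    by (simp add: weyl_fract_def poly_fract_inject)
qed

lemma higher_fract_pderiv_const_denominator:
  assumes "c \<noteq> 0" "pderiv c = 0"
  shows "(fract_pderiv ^^ j) (Fraction_Field.Fract a c) = Fraction_Field.Fract ((pderiv ^^ j) a) c"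
proof (induction j)
  case (Suc j)
  then show ?case using assms
    by (simp add: fract_pderiv_Fract eq_fract mult_ac)
qed simp

lemma dvd_power_diff: "m \<le> n \<Longrightarrow> (h::'a::comm_semiring_1) ^ m dvd h ^ n * f"
  by (simp add: le_imp_power_dvd dvd_mult2)

lemma commutator_mult_right: "commutator b (a * c) = commutator b a * c + a * commutator b c"
  by (simp add: commutator_def algebra_simps)

lemma commutator_add_right: "commutator b (a + c) = commutator b a + commutator b c"
  by (simp add: commutator_def algebra_simps)

lemma commutator_const: "commutator b (weyl_const c) = 0"
  using weyl_const_commute[of c b] by (simp add: commutator_def)

section \<open>The bracket of \<open>D\<^sub>g\<close> with the multiple of \<open>E\<^sub>x\<close>\<close>

text \<open>
  The polynomials \<open>u\<close>, \<open>w = u / \<rho>\<^sub>h\<close> and \<open>z = h\<^sup>p / \<rho>\<^sub>h\<close> are written with the cofactor \<open>k\<close> of \<open>\<rho>\<^sub>h\<close> in \<open>h\<close>;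
  for \<open>w\<close> this needs \<open>p \<ge> 2\<close>.
\<close>
locale bracket_data =
  fixes p :: nat and g h k :: "'a::field poly"
  assumes char_p: "CHAR('a) = p" and p_pos: "p > 0" and h_nz: "h \<noteq> 0" and factor: "h = rho h * k"
begin

definition u where "u = g * h ^ (p - 1)"
definition w where "w = g * h ^ (p - 2) * k"
definition z where "z = h ^ (p - 1) * k"

lemma p_ge_2: "p \<ge> 2"
  using prime_ge_2_nat[OF prime_p[OF char_p p_pos]] .

lemma h_power: "h ^ (p - 1) * h = h ^ p" "h ^ (p - 2) * h = h ^ (p - 1)"
proof -
  have "p = Suc (p - 1)" "p - 1 = Suc (p - 2)" using p_ge_2 by simp_all
  then show "h ^ (p - 1) * h = h ^ p" "h ^ (p - 2) * h = h ^ (p - 1)"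
    by (metis power_Suc2)+
qed

lemmas h_powers = h_power h_power[unfolded One_nat_def]

lemma rho_const: "pderiv (rho h) = 0"
  by (rule pderiv_polys_in_xp) (rule rho_props[OF h_nz])

lemma rho_nz: "rho h \<noteq> 0"
  using factor h_nz by auto

lemma power_p_const: "pderiv (h ^ p) = 0"
  by (rule pderiv_power_p[OF char_p p_pos])

lemma z_rho: "z * rho h = h ^ p"
proof -
  have "z * rho h = h ^ (p - 1) * (rho h * k)" by (simp add: z_def mult_ac)
  then show ?thesis by (simp add: h_powers flip: factor)
qed

lemma w_rho: "w * rho h = u"
proof -
  have "w * rho h = g * (h ^ (p - 2) * (rho h * k))" by (simp add: w_def mult_ac)
  then show ?thesis by (simp add: h_powers u_def flip: factor)
qed

lemma u_h: "u * h = g * h ^ p"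
  by (simp add: u_def h_powers mult.assoc)

lemma z_u: "z * u = h ^ p * w"
  by (simp flip: z_rho w_rho add: mult_ac)

lemma z_g: "z * g = h * w"
  unfolding z_def w_def h_power(2)[symmetric] by (simp add: mult_ac)

lemma z_const: "pderiv z = 0"
proof -
  have "rho h * pderiv z = 0"
    using arg_cong[OF z_rho, of pderiv] by (simp add: pderiv_mult rho_const power_p_const)
  then show ?thesis using rho_nz by simp
qed

lemma higher_pderiv_h: "(pderiv ^^ j) h = rho h * (pderiv ^^ j) k"
  by (subst factor) (rule higher_pderiv_mult_const[OF rho_const])

lemma E_breve_eq: "E_breve h a = weyl_poly z * E_x a"
  using weyl_fract_quotient[OF rho_nz z_rho[symmetric]] by (simp add: E_breve_def char_p)

lemmas E = E_x_derivation[OF char_p p_pos] E_x_X[OF char_p p_pos] E_x_Y[OF char_p p_pos]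
  E_x_poly[OF char_p p_pos]

lemma z_central: "weyl_poly z * a = a * weyl_poly z"
  by (rule weyl_poly_central[OF z_const])

lemma E_breve_derivation:
  "E_breve h (a + b) = E_breve h a + E_breve h b"
  "E_breve h (weyl_const c) = 0"
  "E_breve h (a * b) = E_breve h a * b + a * E_breve h b"
proof -
  show "E_breve h (a + b) = E_breve h a + E_breve h b"
    by (simp add: E_breve_eq derivation_add[OF E(1)] distrib_left)
  show "E_breve h (weyl_const c) = 0"
    by (simp add: E_breve_eq derivation_const[OF E(1)])
  have "weyl_poly z * (a * E_x b) = a * (weyl_poly z * E_x b)"
    by (metis mult.assoc z_central)
  then show "E_breve h (a * b) = E_breve h a * b + a * E_breve h b"
    by (simp add: E_breve_eq derivation_mult[OF E(1)] distrib_left mult.assoc)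
qed

lemma E_breve_poly: "E_breve h (weyl_poly f) = divided_comm p (z * pderiv f) - weyl_poly (z * partial_p f)"
  by (simp add: E_breve_eq E(4) right_diff_distrib weyl_poly_times_divided_comm[OF z_const] weyl_poly_mult)

text \<open>
  As \<open>\<rho>\<^sub>h\<close> is a constant for \<open>d/dx\<close>, it divides \<open>h'\<close>, so that \<open>z h'\<close> is \<open>h\<^sup>p\<close> times a polynomial.  Thus
  all coefficients in the sum are divisible by \<open>h\<^sup>p\<close>, which suffices for powers of \<open>y\<close> up to the \<open>p\<close>-th.
  The remaining term \<open>z \<partial>\<^sub>p(h)\<close> contains a factor \<open>h\<close>, which is absorbed by \<open>y\<close> on its left.
\<close>
lemma E_breve_in_A_sub: "a \<in> A_sub h \<Longrightarrow> E_breve h a \<in> A_sub h"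
proof (induction rule: A_sub_induct)
  case (const c)
  then show ?case by (simp add: E_breve_derivation A_sub_0)
next
  case X
  have "h ^ (p - 1) dvd z" by (simp add: z_def)
  then show ?case unfolding E_breve_eq E by (rule A_sub_Y_power)
next
  case y_hat
  have "E_breve h (y_hat h) = weyl_Y * E_breve h (weyl_poly h)"
  proof -
    have "E_breve h weyl_Y = 0" by (simp add: E_breve_eq E)
    then show ?thesis by (simp add: y_hat_def E_breve_derivation(3))
  qed
  also have "z * pderiv h = h ^ p * pderiv k"
    using higher_pderiv_h[of 1] by (simp flip: z_rho)
  then have "E_breve h (weyl_poly h) = divided_comm p (h ^ p * pderiv k) - weyl_poly (z * partial_p h)"
    by (simp add: E_breve_poly)
  also have "weyl_Y * \<dots> = weyl_Y * divided_comm p (h ^ p * pderiv k)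
      - y_hat h * weyl_poly (h ^ (p - 2) * k * partial_p h)"
  proof -
    have "z * partial_p h = h * (h ^ (p - 2) * k * partial_p h)"
      unfolding z_def h_power(2)[symmetric] by (simp add: mult_ac)
    then show ?thesis
      unfolding right_diff_distrib y_hat_def by (simp only: weyl_poly_mult mult.assoc)
  qed
  also have "\<dots> \<in> A_sub h"
  proof (rule A_sub_diff)
    show "y_hat h * weyl_poly (h ^ (p - 2) * k * partial_p h) \<in> A_sub h"
      by (intro A_sub_mult A_sub_y_hat A_sub_poly)
    have "weyl_Y * (weyl_poly (smult c ((pderiv ^^ j) (h ^ p * pderiv k))) * weyl_Y ^ m) \<in> A_sub h"
      if "m < p" for c j m
      by (rule A_sub_Y_times)
         (use that in \<open>auto simp: higher_pderiv_mult_const[OF power_p_const]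
            intro!: dvd_smult dvd_power_diff simp del: power_Suc\<close>)
    then show "weyl_Y * divided_comm p (h ^ p * pderiv k) \<in> A_sub h"
      unfolding divided_comm_def sum_distrib_left
      by (intro A_sub_sum) (use p_pos in auto)
  qed
  finally show ?case .
qed (simp_all add: E_breve_derivation A_sub_add A_sub_mult)

abbreviation "D \<equiv> D_der h (weyl_poly g)"
abbreviation "B \<equiv> divided_comm p w"

lemmas D_props = D_der_props[OF char_p p_pos h_nz]

text \<open>
  How values of \<open>D\<^sub>g\<close> are found: the derivation of \<open>A\<^sub>1\<close> on the left is \<open>h\<^sup>p D\<^sub>g\<close>.
\<close>
lemma D_eqI:
  assumes "a \<in> A_sub h" "vertical_derivation u a = weyl_poly (h ^ p) * b"
  shows "D a = b"
  using h_power_cancel[OF char_p p_pos h_nz, of "D a" b] D_props(4)[OF assms(1), of g] assms(2)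
  by (simp add: u_def)

lemma D_in_A_sub: "a \<in> A_sub h \<Longrightarrow> D a \<in> A_sub h"
  using D_props(1)[of g] unfolding derivation_on_def by blast

lemma D_rules:
  "a \<in> A_sub h \<Longrightarrow> c \<in> A_sub h \<Longrightarrow> D (a + c) = D a + D c"
  "a \<in> A_sub h \<Longrightarrow> c \<in> A_sub h \<Longrightarrow> D (a * c) = D a * c + a * D c"
  "D (weyl_const d) = 0"
  using D_props(1)[of g] derivation_on_const[OF D_props(1)[of g] A_sub_1] unfolding derivation_on_def by blast+

text \<open>
  Meaningful only on \<open>A\<^sub>h\<close>, since \<open>D\<close> is undefined outside; the aim is \<open>\<Delta> = D\<^sub>e\<close> there.
\<close>
definition "\<Delta> a = D (E_breve h a) - E_breve h (D a) - commutator B a"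

lemma \<Delta>_add: "a \<in> A_sub h \<Longrightarrow> c \<in> A_sub h \<Longrightarrow> \<Delta> (a + c) = \<Delta> a + \<Delta> c"
  by (simp add: \<Delta>_def E_breve_derivation D_rules E_breve_in_A_sub D_in_A_sub commutator_add_right)

lemma \<Delta>_mult: "a \<in> A_sub h \<Longrightarrow> c \<in> A_sub h \<Longrightarrow> \<Delta> (a * c) = \<Delta> a * c + a * \<Delta> c"
  by (simp add: \<Delta>_def E_breve_derivation D_rules E_breve_in_A_sub D_in_A_sub commutator_mult_right
      A_sub_mult algebra_simps)

lemma D_0: "D 0 = 0"
  using D_rules(3)[of 0] by simp

lemma \<Delta>_const: "\<Delta> (weyl_const c) = 0"
  using E_breve_derivation(2)[of 0]
  by (simp add: \<Delta>_def E_breve_derivation D_rules(3) D_0 commutator_const)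

lemma \<Delta>_X: "\<Delta> weyl_X = 0"
proof -
  have "D (weyl_poly z * weyl_Y ^ (p - 1)) = commutator B weyl_X"
  proof (rule D_eqI)
    show "weyl_poly z * weyl_Y ^ (p - 1) \<in> A_sub h"
      by (rule A_sub_Y_power) (simp add: z_def)
    note V = vertical_derivation[of u]
    have "vertical_derivation u (weyl_poly z * weyl_Y ^ (p - 1)) = weyl_poly z * Y_power_derivative (p - 1) u"
      by (simp add: derivation_mult[OF V(1)] derivation_poly_eq_0[OF V(1,2)] derivation_Y_power[OF V(1,3)])
    also have "Y_power_derivative (p - 1) u = commutator (weyl_poly (rho h) * B) weyl_X"
      by (simp add: weyl_poly_times_divided_comm[OF rho_const] w_rho mult.commute[of "rho h"]
          divided_comm_X[OF char_p p_pos])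
    also have "\<dots> = weyl_poly (rho h) * commutator B weyl_X"
    proof -
      have "weyl_X * (weyl_poly (rho h) * B) = weyl_poly (rho h) * (weyl_X * B)"
        by (metis mult.assoc weyl_poly_central[OF rho_const])
      then show ?thesis by (simp add: commutator_def right_diff_distrib mult.assoc)
    qed
    also have "weyl_poly z * \<dots> = weyl_poly (h ^ p) * commutator B weyl_X"
      by (simp add: weyl_poly_mult flip: z_rho mult.assoc)
    finally show "vertical_derivation u (weyl_poly z * weyl_Y ^ (p - 1)) = weyl_poly (h ^ p) * commutator B weyl_X" .
  qed
  moreover have "E_breve h 0 = 0" using E_breve_derivation(2)[of 0] by simp
  ultimately show ?thesis by (simp add: \<Delta>_def E_breve_eq E(2) D_props(2))
qed

lemma \<Delta>_poly: "\<Delta> (weyl_poly f) = 0"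
proof (induction f)
  case 0
  then show ?case using \<Delta>_const[of 0] by simp
next
  case (pCons c f)
  then show ?case
    by (simp add: weyl_poly_pCons \<Delta>_add \<Delta>_mult \<Delta>_const \<Delta>_X A_sub_const A_sub_X A_sub_poly A_sub_mult)
qed

text \<open>
  The sum in the formula for \<open>e\<close>, and its quotient by \<open>\<rho>\<^sub>h\<close>, which is a polynomial because \<open>\<rho>\<^sub>h\<close> divides
  all derivatives of \<open>h\<close>.
\<close>
definition "S = (\<Sum>j=1..p-1. smult ((- 1) ^ (j - 1) / of_nat j) ((pderiv ^^ j) u * (pderiv ^^ (p - j)) h))"
definition "S' = (\<Sum>j=1..p-1. smult ((- 1) ^ (j - 1) / of_nat j) ((pderiv ^^ j) u * (pderiv ^^ (p - j)) k))"

lemma S_rho: "S' * rho h = S"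
  unfolding S_def S'_def sum_distrib_right higher_pderiv_h
  by (intro sum.cong) (simp_all add: mult_ac)

definition "r = S' + (z * partial_p g - w * partial_p h)"

lemma r_rho: "r * rho h = S + h ^ (p - 1) * (h * partial_p g - g * partial_p h)"
proof -
  have "r * rho h = S' * rho h + (z * rho h * partial_p g - w * rho h * partial_p h)"
    by (simp add: r_def algebra_simps)
  also have "\<dots> = S + (h ^ (p - 1) * h * partial_p g - g * h ^ (p - 1) * partial_p h)"
    by (simp only: S_rho z_rho w_rho h_power u_def)
  finally show ?thesis by (simp add: algebra_simps)
qed

text \<open>
  The Leibniz rule of \<open>\<partial>\<^sub>p\<close> for the two sides of \<open>u h = g h\<^sup>p\<close>.  For \<open>g h\<^sup>p\<close> it has no error term, as
  the derivatives of \<open>h\<^sup>p\<close> vanish; for \<open>u h\<close> the error term is \<open>S\<close>.  The terms with \<open>\<partial>\<^sub>p(h\<^sup>p)\<close> cancel.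
\<close>
lemma r_identity: "h * (z * partial_p u - w * partial_p (h ^ p)) = h ^ p * r"
proof -
  note prod = partial_p_mult[OF char_p p_pos]
  have gh: "partial_p (g * h ^ p) = g * partial_p (h ^ p) + h ^ p * partial_p g"
  proof -
    have "(pderiv ^^ (p - j)) (h ^ p) = 0" if "j \<in> {1..p-1}" for j
    proof -
      have "(pderiv ^^ Suc (p - j - 1)) (h ^ p) = 0"
        by (simp only: funpow_Suc_right comp_apply power_p_const higher_pderiv_0)
      moreover have "Suc (p - j - 1) = p - j" using that by auto
      ultimately show ?thesis by metis
    qed
    then show ?thesis by (simp add: prod)
  qed
  have "h * partial_p u = partial_p (u * h) - u * partial_p h + S"
    by (simp add: prod S_def)
  also have "\<dots> = g * partial_p (h ^ p) + h ^ p * partial_p g - u * partial_p h + S"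
    by (simp add: u_h gh)
  finally have hu: "h * partial_p u = \<dots>" .
  have "h * (z * partial_p u - w * partial_p (h ^ p)) = z * (h * partial_p u) - h * w * partial_p (h ^ p)"
    by (simp add: algebra_simps)
  also have "\<dots> = z * g * partial_p (h ^ p) + z * (h ^ p * partial_p g) - z * u * partial_p h + z * S
      - h * w * partial_p (h ^ p)"
    unfolding hu by (simp add: algebra_simps)
  also have "\<dots> = z * (h ^ p * partial_p g) - h ^ p * w * partial_p h + z * rho h * S'"
    unfolding z_g z_u S_rho[symmetric] by (simp add: algebra_simps)
  also have "\<dots> = h ^ p * r"
    unfolding z_rho r_def by (simp add: algebra_simps)
  finally show ?thesis .
qed

text \<open>
  As \<open>\<Delta>\<close> kills polynomials, \<open>\<Delta>(y h) h\<^bsup>p-1\<^esup> = \<Delta>(h\<^sup>p y)\<close>, and \<open>h\<^sup>p y\<close> is an element on which all three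
  parts of \<open>\<Delta>\<close> are explicit.  The parts with powers of \<open>y\<close> come from \<open>z E\<^sub>x(u)\<close> and from \<open>[b, h\<^sup>p y]\<close>;
  they cancel because \<open>z u' = h\<^sup>p w'\<close>.
\<close>
lemma \<Delta>_y_hat: "\<Delta> (y_hat h) = weyl_poly r"
proof -
  note V = vertical_derivation[of u]
  let ?H = "weyl_poly (h ^ p) * weyl_Y"
  let ?P = "partial_p (h ^ p)"
  have H_central: "weyl_poly (h ^ p) * a = a * weyl_poly (h ^ p)" for a
    by (rule weyl_poly_central[OF power_p_const])
  have H: "y_hat h * weyl_poly (h ^ (p - 1)) = ?H"
    unfolding y_hat_def mult.assoc H_central
    by (simp add: mult.commute[of h] h_powers flip: weyl_poly_mult)
  then have "\<Delta> ?H = \<Delta> (y_hat h) * weyl_poly (h ^ (p - 1))"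
    by (metis \<Delta>_mult \<Delta>_poly A_sub_y_hat A_sub_poly mult_zero_right add_0_right)
  moreover have H_in: "?H \<in> A_sub h"
    unfolding H[symmetric] by (intro A_sub_mult A_sub_y_hat A_sub_poly)
  have V_Y: "vertical_derivation u (weyl_poly f * weyl_Y) = weyl_poly f * weyl_poly u" for f
    by (simp add: derivation_mult[OF V(1)] derivation_poly_eq_0[OF V(1,2)] V(3))
  have DH: "D ?H = weyl_poly u"
    by (rule D_eqI[OF H_in V_Y])
  have EH: "E_breve h ?H = weyl_poly (- (z * ?P)) * weyl_Y"
  proof -
    have "E_breve h weyl_Y = 0" by (simp add: E_breve_eq E)
    moreover have "divided_comm p 0 = (0 :: 'a weyl)" by (simp add: divided_comm_def)
    ultimately show ?thesis
      by (simp add: E_breve_derivation(3) E_breve_poly power_p_const weyl_poly_uminus)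
  qed
  have DEH: "D (E_breve h ?H) = weyl_poly (- (w * ?P))"
  proof (rule D_eqI)
    show "E_breve h ?H \<in> A_sub h" by (rule E_breve_in_A_sub[OF H_in])
    have "- (z * ?P) * u = h ^ p * - (w * ?P)"
      using z_u by (simp add: mult_ac)
    then show "vertical_derivation u (E_breve h ?H) = weyl_poly (h ^ p) * weyl_poly (- (w * ?P))"
      unfolding EH V_Y by (simp only: flip: weyl_poly_mult)
  qed
  have "commutator B ?H = - divided_comm p (z * pderiv u)"
  proof -
    have "commutator B ?H = - (weyl_poly (h ^ p) * commutator weyl_Y B)"
      by (simp add: commutator_def right_diff_distrib H_central mult.assoc)
    moreover have "h ^ p * pderiv w = z * pderiv u"
      using arg_cong[OF z_u, of pderiv] by (simp add: pderiv_mult z_const power_p_const)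
    ultimately show ?thesis
      by (simp add: commutator_Y_divided_comm weyl_poly_times_divided_comm[OF power_p_const])
  qed
  then have "\<Delta> ?H = weyl_poly (z * partial_p u - w * ?P)"
    unfolding \<Delta>_def DH DEH E_breve_poly by (simp add: weyl_poly_diff weyl_poly_uminus)
  ultimately have "\<Delta> (y_hat h) * weyl_poly (h ^ (p - 1)) = weyl_poly (z * partial_p u - w * ?P)"
    by simp
  then have "\<Delta> (y_hat h) * weyl_poly (h ^ (p - 1)) * weyl_poly h
      = weyl_poly (h * (z * partial_p u - w * ?P))"
    by (simp only: weyl_poly_mult[symmetric] mult.commute[of h])
  then have "weyl_poly (h ^ p) * \<Delta> (y_hat h) = weyl_poly (h ^ p) * weyl_poly r"
    unfolding r_identity weyl_poly_mult mult.assoc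
    by (simp add: H_central[of "\<Delta> _"] h_powers flip: weyl_poly_mult)
  then show ?thesis by (rule h_power_cancel[OF char_p p_pos h_nz])
qed

lemma \<Delta>_eq_D_der: "a \<in> A_sub h \<Longrightarrow> \<Delta> a = D_der h (weyl_poly r) a"
proof (induction rule: A_sub_induct)
  case (const c)
  then show ?case using derivation_on_const[OF D_props(1) A_sub_1] by (simp add: \<Delta>_const)
next
  case X
  then show ?case by (simp add: \<Delta>_X D_props(2))
next
  case y_hat
  then show ?case by (simp add: \<Delta>_y_hat D_props(3))
next
  case (add a c)
  then show ?case using D_props(1)[of r] by (simp add: \<Delta>_add derivation_on_def)
next
  case (mult a c)
  then show ?case using D_props(1)[of r] by (simp add: \<Delta>_mult derivation_on_def)
qed

text \<open>
  On \<open>A\<^sub>h\<close>, \<open>ad\<^sub>b\<close> is the difference of \<open>[D\<^sub>g, z E\<^sub>x]\<close> and \<open>D\<^sub>e\<close>, which map \<open>A\<^sub>h\<close> to itself.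
\<close>
lemma B_in_normalizer: "B \<in> normalizer h"
  unfolding normalizer_def
proof (intro CollectI ballI)
  fix a assume a: "a \<in> A_sub h"
  have "commutator B a = D (E_breve h a) - E_breve h (D a) - D_der h (weyl_poly r) a"
    using \<Delta>_eq_D_der[OF a] by (simp add: \<Delta>_def algebra_simps)
  moreover have "D_der h (weyl_poly r) a \<in> A_sub h"
    using D_props(1)[of r] a unfolding derivation_on_def by blast
  ultimately show "commutator B a \<in> A_sub h"
    using a by (simp add: A_sub_diff D_in_A_sub E_breve_in_A_sub)
qed

text \<open>
  Since \<open>1 / (p - k) = - 1 / k\<close>, the coefficients agree, and the leading term is the one for \<open>k = 1\<close>.
  The rational coefficients are polynomials because \<open>g / h = u / h\<^sup>p\<close> has a denominator with
  derivative 0.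
\<close>
lemma B_eq:
  "B = weyl_fract (poly_fract (g * h ^ (p - 1)) / poly_fract (rho h)) * weyl_Y ^ (p - 1)
     + (\<Sum>k=2..p-1. (- 1) ^ k *
          (weyl_fract ((fract_pderiv ^^ (k - 1)) (poly_fract g / poly_fract h)
                         * poly_fract (h ^ p) / poly_fract (rho h))
           * (weyl_const (1 / of_nat (p - k)) * weyl_Y ^ (p - k))))"
proof -
  let ?t = "\<lambda>j. weyl_poly (smult ((- 1) ^ (j - 1) / of_nat j) ((pderiv ^^ (j - 1)) w)) * weyl_Y ^ (p - j)"
  have w: "weyl_fract (poly_fract (g * h ^ (p - 1)) / poly_fract (rho h)) = weyl_poly w"
    using weyl_fract_quotient[OF rho_nz, of u w] w_rho by (simp add: u_def)
  have frac: "(fract_pderiv ^^ j) (poly_fract g / poly_fract h) * poly_fract (h ^ p) / poly_fract (rho h)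
     = poly_fract ((pderiv ^^ j) u) / poly_fract (rho h)" for j
  proof -
    have 1: "poly_fract g / poly_fract h = Fraction_Field.Fract u (h ^ p)"
      using h_nz u_h by (simp add: eq_fract mult.commute)
    have 2: "(fract_pderiv ^^ j) (Fraction_Field.Fract u (h ^ p))
        = Fraction_Field.Fract ((pderiv ^^ j) u) (h ^ p)"
      by (rule higher_fract_pderiv_const_denominator) (use h_nz power_p_const in simp_all)
    show ?thesis
      unfolding 1 2 using h_nz rho_nz by (simp add: eq_fract)
  qed
  have wj: "weyl_fract ((fract_pderiv ^^ j) (poly_fract g / poly_fract h) * poly_fract (h ^ p) / poly_fract (rho h))
     = weyl_poly ((pderiv ^^ j) w)" for j
    unfolding frac
  proof (rule weyl_fract_quotient[OF rho_nz])
    show "(pderiv ^^ j) u = (pderiv ^^ j) w * rho h"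
      using higher_pderiv_mult_const[OF rho_const, of j w] w_rho by (simp add: mult.commute)
  qed
  have "B = ?t 1 + (\<Sum>j=2..p-1. ?t j)"
    unfolding divided_comm_def
    by (subst sum.atLeast_Suc_atMost) (use p_ge_2 in \<open>simp_all add: numeral_2_eq_2\<close>)
  also have "?t 1 = weyl_poly w * weyl_Y ^ (p - 1)" by simp
  also have "(\<Sum>j=2..p-1. ?t j) = (\<Sum>k=2..p-1. (- 1) ^ k *
          (weyl_poly ((pderiv ^^ (k - 1)) w) * (weyl_const (1 / of_nat (p - k)) * weyl_Y ^ (p - k))))"
  proof (intro sum.cong refl)
    fix j assume j: "j \<in> {2..p-1}"
    then obtain i where i: "j = Suc i" by (cases j) auto
    have c: "(- 1) ^ (j - 1) / of_nat j = (- 1) ^ j * (1 / of_nat (p - j) :: 'a)"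
      using of_nat_p_minus[OF char_p p_pos, of j] j by (auto simp: i simp del: of_nat_Suc of_nat_diff)
    have m1: "weyl_const ((- 1) ^ n) = (- 1 :: 'a weyl) ^ n" for n
      by (induction n) (simp_all add: weyl_const_uminus)
    have "?t j = weyl_const ((- 1) ^ j) * (weyl_const (1 / of_nat (p - j)) * weyl_poly ((pderiv ^^ (j - 1)) w)) * weyl_Y ^ (p - j)"
      unfolding c weyl_poly_smult weyl_const_mult by (simp only: mult.assoc)
    then show "?t j = (- 1) ^ j *
          (weyl_poly ((pderiv ^^ (j - 1)) w) * (weyl_const (1 / of_nat (p - j)) * weyl_Y ^ (p - j)))"
      unfolding m1 weyl_const_commute[of _ "weyl_poly _"] by (simp only: mult.assoc)
  qed
  finally show ?thesis unfolding w wj .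
qed

end

theorem proposition6p40:
  fixes g h :: "'a::field poly" and p :: nat and b e :: "'a weyl"
  assumes char: "CHAR('a) = p" "p > 0"
    and h: "h \<noteq> 0"
    and b: "b = weyl_fract (poly_fract (g * h ^ (p - 1)) / poly_fract (rho h)) * weyl_Y ^ (p - 1)
              + (\<Sum>k=2..p-1. (- 1) ^ k *
                   (weyl_fract ((fract_pderiv ^^ (k - 1)) (poly_fract g / poly_fract h)
                                  * poly_fract (h ^ p) / poly_fract (rho h))
                    * (weyl_const (1 / of_nat (p - k)) * weyl_Y ^ (p - k))))"
    and e: "e = map_commutator (D_der h (weyl_poly g)) (E_breve h) (y_hat h)
              - commutator b (y_hat h)"
  shows "b \<in> normalizer h \<and>
         e \<in> centralizer_X h \<and>
         (\<forall>a\<in>A_sub h. map_commutator (D_der h (weyl_poly g)) (E_breve h) a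
                        = D_der h e a + commutator b a) \<and>
         (\<exists>r. e = weyl_poly r \<and>
           poly_fract r =
             1 / poly_fract (rho h) *
               poly_fract (\<Sum>k=1..p-1. smult ((- 1) ^ (k - 1) / of_nat k)
                             ((pderiv ^^ k) (g * h ^ (p - 1)) * (pderiv ^^ (p - k)) h))
             + poly_fract (h ^ (p - 1)) / poly_fract (rho h) *
                 poly_fract (h * partial_p g - g * partial_p h))"
proof -
  obtain k where k: "h = rho h * k"
    using rho_props(3)[OF h] by (rule dvdE)
  interpret bracket_data p g h k
    by unfold_locales (use char h k in auto)
  have b_eq: "b = B" unfolding b B_eq ..
  have bracket: "map_commutator D (E_breve h) a = \<Delta> a + commutator b a" for a
    by (simp add: \<Delta>_def map_commutator_def b_eq)
  have e_eq: "e = weyl_poly r"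
    by (simp add: e bracket \<Delta>_y_hat)
  have "e \<in> centralizer_X h"
    using weyl_poly_commute[of r "[:0, 1:]"]
    by (simp add: centralizer_X_def e_eq A_sub_poly weyl_poly_X)
  moreover have "map_commutator D (E_breve h) a = D_der h e a + commutator b a" if "a \<in> A_sub h" for a
    using \<Delta>_eq_D_der[OF that] by (simp add: bracket e_eq)
  moreover have "poly_fract r = 1 / poly_fract (rho h) * poly_fract S
      + poly_fract (h ^ (p - 1)) / poly_fract (rho h) * poly_fract (h * partial_p g - g * partial_p h)"
  proof -
    have "poly_fract r = poly_fract (S + h ^ (p - 1) * (h * partial_p g - g * partial_p h)) / poly_fract (rho h)"
      using rho_nz r_rho by (simp add: eq_fract)
    also have "\<dots> = 1 / poly_fract (rho h) * poly_fract S
      + poly_fract (h ^ (p - 1)) / poly_fract (rho h) * poly_fract (h * partial_p g - g * partial_p h)"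
      using rho_nz by (simp add: One_fract_def eq_fract algebra_simps)
    finally show ?thesis .
  qed
  ultimately show ?thesis
    using B_in_normalizer e_eq unfolding b_eq S_def u_def by blast
qed

end
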